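(* Let $m$ be an infinite cardinal. If $\Pi$ is a quasi-free profinite group of rank $m$, then its (closed) commutator subgroup $\Pi'$ is also a quasi-free profinite group of rank $m$.
   Context: All homomorphisms of profinite groups are required to be continuous. The commutator subgroup $\Pi'$ of a profinite group $\Pi$ means the closed subgroup topologically generated by all commutators. A finite split embedding problem for a profinite group $\Pi$ is a pair of epimorphisms $(\alpha:\Pi\to G,\ f:\Gamma\to G)$ with $\Gamma$ finite, together with a homomorphism $s:G\to\Gamma$ satisfying $f\circ s=\mathrm{id}_G$. It is non-trivial if $\ker f\neq 1$. A proper solution is a surjective homomorphism $\lambda:\Pi\to\Gamma$ with $f\circ\lambda=\alpha$. For an infinite cardinal $m$, the group $\Pi$ is quasi-free of rank $m$ if every non-trivial finite split embedding problem for $\Pi$ has exactly $m$ proper solutions. *)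

theory Defs
  imports "HOL-Analysis.Analysis" "HOL-Algebra.Generated_Groups" "HOL-Algebra.Weak_Morphisms"
begin

unbundle cardinal_syntax
no_notation Set_Algebras.elt_set_eq (infix \<open>=o\<close> 50)

definition totally_disconnected_space :: "'a topology \<Rightarrow> bool" where
  "totally_disconnected_space T \<longleftrightarrow> (\<forall>S. connectedin T S \<longrightarrow> (\<exists>a. S \<subseteq> {a}))"

locale topological_group = group P for P (structure) and T :: "'a topology" +
  assumes topspace_eq: "topspace T = carrier P"
    and continuous_mult: "continuous_map (prod_topology T T) T (\<lambda>(x, y). x \<otimes> y)"
    and continuous_inv: "continuous_map T T (\<lambda>x. inv x)"

locale profinite_group = topological_group +
  assumes compact: "compact_space T"
    and Hausdorff: "Hausdorff_space T"
    and totally_disconnected: "totally_disconnected_space T"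

definition closed_commutator_subgroup :: "('a, 'b) monoid_scheme \<Rightarrow> 'a topology \<Rightarrow> 'a set" where
  "closed_commutator_subgroup P T = T closure_of (derived P (carrier P))"

text \<open>Finite groups carry the discrete topology, so continuity is a condition only on maps out
  of \<open>P\<close>. The group \<open>G\<close> is finite, being an image of \<open>H\<close>.\<close>

locale finite_split_embedding_problem =
  fixes P :: "('a, 'b) monoid_scheme" and T :: "'a topology"
    and G :: "('g, 'c) monoid_scheme" and H :: "('h, 'd) monoid_scheme"
    and \<alpha> :: "'a \<Rightarrow> 'g" and f :: "'h \<Rightarrow> 'g" and s :: "'g \<Rightarrow> 'h"
  assumes group_G: "group G"
    and group_H: "group H"
    and finite_H: "finite (carrier H)"
    and alpha_epi: "\<alpha> \<in> epi P G"
    and alpha_continuous: "continuous_map T (discrete_topology (carrier G)) \<alpha>"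
    and f_epi: "f \<in> epi H G"
    and s_hom: "s \<in> hom G H"
    and f_s: "\<And>x. x \<in> carrier G \<Longrightarrow> f (s x) = x"

definition nontrivial_embedding_problem ::
  "('g, 'c) monoid_scheme \<Rightarrow> ('h, 'd) monoid_scheme \<Rightarrow> ('h \<Rightarrow> 'g) \<Rightarrow> bool" where
  "nontrivial_embedding_problem G H f \<longleftrightarrow> kernel H G f \<noteq> {\<one>\<^bsub>H\<^esub>}"

text \<open>Solutions are taken extensional on \<open>carrier P\<close>, so that two of them are counted as
  different only if they differ as maps on the group.\<close>

definition proper_solutions ::
  "('a, 'b) monoid_scheme \<Rightarrow> 'a topology \<Rightarrow> ('h, 'd) monoid_scheme
    \<Rightarrow> ('a \<Rightarrow> 'g) \<Rightarrow> ('h \<Rightarrow> 'g) \<Rightarrow> ('a \<Rightarrow> 'h) set" where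
  "proper_solutions P T H \<alpha> f =
    {l \<in> extensional (carrier P).
       l \<in> epi P H \<and> continuous_map T (discrete_topology (carrier H)) l \<and>
       (\<forall>x\<in>carrier P. f (l x) = \<alpha> x)}"

text \<open>A definition cannot quantify over types, so the finite groups are taken with carriers in
  \<open>nat\<close>. As every finite group is isomorphic to such a group, this loses nothing:
  lemma \<open>quasi_free_proper_solutions\<close> below recovers the condition for finite groups on
  arbitrary types.\<close>

definition quasi_free :: "('a, 'b) monoid_scheme \<Rightarrow> 'a topology \<Rightarrow> 'm rel \<Rightarrow> bool" where
  "quasi_free P T m \<longleftrightarrow>
     profinite_group P T \<and>
     (\<forall>(G :: nat monoid) (H :: nat monoid) \<alpha> f s.
        finite_split_embedding_problem P T G H \<alpha> f s \<and> nontrivial_embedding_problem G H f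
        \<longrightarrow> |proper_solutions P T H \<alpha> f| =o m)"

lemma iso_image_group:
  assumes "group G" "inj_on p (carrier G)"
  shows "group (image_group p G)" "p \<in> iso G (image_group p G)"
    "inv_into (carrier G) p \<in> iso (image_group p G) G"
proof -
  interpret group G by fact
  show 1: "p \<in> iso G (image_group p G)"
    using assms(2) by (auto simp: iso_def hom_def image_group_def bij_betw_def)
  have "group (image_group p G \<lparr>one := p \<one>\<^bsub>G\<^esub>\<rparr>)"
    using iso_imp_img_group[OF 1] .
  thus "group (image_group p G)" by (simp add: image_group_def)
  show "inv_into (carrier G) p \<in> iso (image_group p G) G"
    using iso_set_sym[OF 1] by simp
qed

lemma continuous_map_discrete_comp:
  assumes "continuous_map T (discrete_topology A) l" "g \<in> A \<rightarrow> B"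
    and "\<And>x. x \<in> topspace T \<Longrightarrow> l' x = g (l x)"
  shows "continuous_map T (discrete_topology B) l'"
proof -
  have "continuous_map (discrete_topology A) (discrete_topology B) g"
    using assms(2) by simp
  from continuous_map_compose[OF assms(1) this] show ?thesis
    by (rule continuous_map_eq) (simp add: assms(3))
qed

lemma epi_comp_iso:
  assumes "l \<in> epi P A" "g \<in> iso A B" "group P" "\<And>x. x \<in> carrier P \<Longrightarrow> l' x = g (l x)"
  shows "l' \<in> epi P B"
proof -
  have cl: "\<And>x. x \<in> carrier P \<Longrightarrow> l x \<in> carrier A"
    using assms(1) by (auto simp: epi_def hom_def)
  have "l' ` carrier P = g ` (l ` carrier P)"
    using assms(4) by (auto simp: image_image)
  also have "\<dots> = carrier B"
    using assms(1,2) by (auto simp: epi_def iso_def bij_betw_def)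
  finally have im: "l' ` carrier P = carrier B" .
  have "l' (x \<otimes>\<^bsub>P\<^esub> y) = l' x \<otimes>\<^bsub>B\<^esub> l' y" if "x \<in> carrier P" "y \<in> carrier P" for x y
    using that assms cl[of x] cl[of y] group.subgroup_self[OF \<open>group P\<close>]
    by (simp add: epi_def iso_def hom_def Pi_iff monoid.m_closed group.is_monoid)
  with im show ?thesis by (auto simp: epi_def hom_def)
qed

lemma proper_solutions_image_group:
  assumes P: "group P" "topspace T = carrier P" and H: "group H" and q: "inj_on q (carrier H)"
    and p: "inj_on p A" "f \<in> carrier H \<rightarrow> A" "\<alpha> \<in> carrier P \<rightarrow> A"
  shows "|proper_solutions P T H \<alpha> f| =o
    |proper_solutions P T (image_group q H) (\<lambda>x. p (\<alpha> x)) (\<lambda>y. p (f (inv_into (carrier H) q y)))|"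
    (is "|?S| =o |?S'|")
proof -
  let ?r = "inv_into (carrier H) q"
  let ?H = "image_group q H"
  note iq = iso_image_group[OF H q]
  have c: "carrier ?H = q ` carrier H" by (simp add: image_group_def)
  have fwd: "restrict (\<lambda>x. q (l x)) (carrier P) \<in> ?S'" if "l \<in> ?S" for l
  proof -
    have l: "l \<in> epi P H" "continuous_map T (discrete_topology (carrier H)) l"
      "\<And>x. x \<in> carrier P \<Longrightarrow> f (l x) = \<alpha> x"
      using that by (auto simp: proper_solutions_def)
    have cl: "\<And>x. x \<in> carrier P \<Longrightarrow> l x \<in> carrier H" using l(1) by (auto simp: epi_def hom_def)
    have "restrict (\<lambda>x. q (l x)) (carrier P) \<in> epi P ?H"
      by (rule epi_comp_iso[OF l(1) iq(2) P(1)]) simp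
    moreover have "continuous_map T (discrete_topology (carrier ?H)) (restrict (\<lambda>x. q (l x)) (carrier P))"
      by (rule continuous_map_discrete_comp[OF l(2), of q]) (auto simp: c P(2))
    ultimately show ?thesis
      using l(3) cl q by (auto simp: proper_solutions_def)
  qed
  have bwd: "restrict (\<lambda>x. ?r (l x)) (carrier P) \<in> ?S" if "l \<in> ?S'" for l
  proof -
    have l: "l \<in> epi P ?H" "continuous_map T (discrete_topology (carrier ?H)) l"
      "\<And>x. x \<in> carrier P \<Longrightarrow> p (f (?r (l x))) = p (\<alpha> x)"
      using that by (auto simp: proper_solutions_def)
    have cl: "\<And>x. x \<in> carrier P \<Longrightarrow> l x \<in> q ` carrier H"
      using l(1) c by (auto simp: epi_def hom_def)
    have r: "\<And>x. x \<in> carrier P \<Longrightarrow> ?r (l x) \<in> carrier H" using cl by (auto intro: inv_into_into)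
    have "f (?r (l x)) = \<alpha> x" if "x \<in> carrier P" for x
      using inj_onD[OF p(1) l(3)[OF that]] r[OF that] that p by auto
    moreover have "restrict (\<lambda>x. ?r (l x)) (carrier P) \<in> epi P H"
      by (rule epi_comp_iso[OF l(1) iq(3) P(1)]) simp
    moreover have "continuous_map T (discrete_topology (carrier H)) (restrict (\<lambda>x. ?r (l x)) (carrier P))"
      by (rule continuous_map_discrete_comp[OF l(2), of ?r]) (auto simp: c P(2) intro: inv_into_into)
    ultimately show ?thesis by (auto simp: proper_solutions_def)
  qed
  have "bij_betw (\<lambda>l. restrict (\<lambda>x. q (l x)) (carrier P)) ?S ?S'"
  proof (rule bij_betw_byWitness[where f' = "\<lambda>l. restrict (\<lambda>x. ?r (l x)) (carrier P)"])
    show "\<forall>l\<in>?S. restrict (\<lambda>x. ?r (restrict (\<lambda>x. q (l x)) (carrier P) x)) (carrier P) = l"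
    proof
      fix l assume "l \<in> ?S"
      hence "l \<in> extensional (carrier P)" "\<And>x. x \<in> carrier P \<Longrightarrow> l x \<in> carrier H"
        by (auto simp: proper_solutions_def epi_def hom_def)
      thus "restrict (\<lambda>x. ?r (restrict (\<lambda>x. q (l x)) (carrier P) x)) (carrier P) = l"
        using q by (intro extensionalityI[of _ "carrier P"]) auto
    qed
    show "\<forall>l\<in>?S'. restrict (\<lambda>x. q (restrict (\<lambda>x. ?r (l x)) (carrier P) x)) (carrier P) = l"
    proof
      fix l assume "l \<in> ?S'"
      hence "l \<in> extensional (carrier P)" "\<And>x. x \<in> carrier P \<Longrightarrow> l x \<in> q ` carrier H"
        by (auto simp: proper_solutions_def epi_def hom_def c)
      thus "restrict (\<lambda>x. q (restrict (\<lambda>x. ?r (l x)) (carrier P) x)) (carrier P) = l"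
        by (intro extensionalityI[of _ "carrier P"]) (auto simp: f_inv_into_f)
    qed
  qed (use fwd bwd in blast)+
  thus ?thesis using card_of_ordIso by blast
qed

lemma quasi_free_proper_solutions:
  assumes qf: "quasi_free P T m"
    and ep: "finite_split_embedding_problem P T G H \<alpha> f s"
    and nt: "nontrivial_embedding_problem G H f"
  shows "|proper_solutions P T H \<alpha> f| =o m"
proof -
  interpret profinite_group P T using qf by (simp add: quasi_free_def)
  interpret ep: finite_split_embedding_problem P T G H \<alpha> f s by fact
  have fG: "f ` carrier H = carrier G" and fhom: "f \<in> hom H G"
    using ep.f_epi by (auto simp: epi_def)
  have finG: "finite (carrier G)" using fG ep.finite_H by (metis finite_imageI)
  obtain p :: "_ \<Rightarrow> nat" where p: "inj_on p (carrier G)"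
    using finite_imp_inj_to_nat_seg[OF finG] by blast
  obtain q :: "_ \<Rightarrow> nat" where q: "inj_on q (carrier H)"
    using finite_imp_inj_to_nat_seg[OF ep.finite_H] by blast
  let ?G = "image_group p G" and ?H = "image_group q H"
  let ?r = "inv_into (carrier H) q" and ?t = "inv_into (carrier G) p"
  let ?a = "\<lambda>x. p (\<alpha> x)" and ?f = "\<lambda>y. p (f (?r y))" and ?s = "\<lambda>x. q (s (?t x))"
  note ip = iso_image_group[OF ep.group_G p] and iq = iso_image_group[OF ep.group_H q]
  have cG: "carrier ?G = p ` carrier G" and cH: "carrier ?H = q ` carrier H"
    by (simp_all add: image_group_def)
  have s: "\<And>x. x \<in> carrier G \<Longrightarrow> s x \<in> carrier H"
    using ep.s_hom by (auto simp: hom_def)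
  have "finite_split_embedding_problem P T ?G ?H ?a ?f ?s"
  proof (rule finite_split_embedding_problem.intro)
    show "group ?G" "group ?H" by (rule ip(1) iq(1))+
    show "finite (carrier ?H)" using ep.finite_H cH by simp
    show "?a \<in> epi P ?G"
      by (rule epi_comp_iso[OF ep.alpha_epi ip(2)]) (auto intro: is_group)
    show "continuous_map T (discrete_topology (carrier ?G)) ?a"
      by (rule continuous_map_discrete_comp[OF ep.alpha_continuous, of p]) (auto simp: cG)
    have "?r \<in> epi ?H H" using iq(3) by (auto simp: epi_def iso_def bij_betw_def)
    hence "(\<lambda>y. f (?r y)) \<in> epi ?H G"
      using ep.f_epi Group.hom_compose[of ?r ?H H f G] by (auto simp: epi_def comp_def image_image[symmetric])
    thus "?f \<in> epi ?H ?G" by (rule epi_comp_iso[OF _ ip(2) iq(1)]) simp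
    have "?t \<in> hom ?G G" "q \<in> hom H ?H" using ip(3) iq(2) by (auto simp: iso_def)
    thus "?s \<in> hom ?G ?H"
      using Group.hom_compose[OF Group.hom_compose[OF _ ep.s_hom], of ?t ?G q ?H] by (simp add: comp_def)
    show "?f (?s x) = x" if "x \<in> carrier ?G" for x
      using that p q s ep.f_s by (auto simp: cG)
  qed
  moreover have "nontrivial_embedding_problem ?G ?H ?f"
  proof -
    have f1: "f \<one>\<^bsub>H\<^esub> = \<one>\<^bsub>G\<^esub>"
      using hom_one[OF fhom ep.group_H ep.group_G] .
    have oH: "\<one>\<^bsub>H\<^esub> \<in> carrier H" and oG: "\<one>\<^bsub>G\<^esub> \<in> carrier G"
      using ep.group_H ep.group_G by (auto simp: group.is_monoid monoid.one_closed)
    have "\<one>\<^bsub>H\<^esub> \<in> kernel H G f" using f1 oH by (simp add: kernel_def)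
    then obtain h where h: "h \<in> kernel H G f" "h \<noteq> \<one>\<^bsub>H\<^esub>"
      using nt unfolding nontrivial_embedding_problem_def by blast
    have "q h \<in> kernel ?H ?G ?f" "q h \<noteq> \<one>\<^bsub>?H\<^esub>"
      using h q oH by (auto simp: kernel_def image_group_def inj_on_eq_iff)
    thus ?thesis unfolding nontrivial_embedding_problem_def by blast
  qed
  ultimately have "|proper_solutions P T ?H ?a ?f| =o m"
    using qf unfolding quasi_free_def by blast
  moreover have "|proper_solutions P T H \<alpha> f| =o |proper_solutions P T ?H ?a ?f|"
    using ep.alpha_epi fG
    by (intro proper_solutions_image_group[where A = "carrier G"] is_group topspace_eq ep.group_H q p)
      (auto simp: epi_def hom_def)
  ultimately show ?thesis using ordIso_transitive by blast
qed

end

theory Submission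
  imports Defs "HOL-Algebra.Elementary_Groups"
begin

text \<open>
  Write \<open>N\<close> for the closed commutator subgroup of \<open>P\<close>, and consider a finite split embedding
  problem \<open>(\<alpha> : N \<rightarrow> G, f : H \<rightarrow> G, s)\<close> with kernel \<open>K \<noteq> 1\<close>. It has to be related to problems
  for \<open>P\<close>, though neither \<open>\<alpha>\<close> nor the action of \<open>G\<close> on \<open>K\<close> need extend to \<open>P\<close>.

  Existence of solutions. Since \<open>P\<close> is profinite, \<open>\<alpha>\<close> factors through the image \<open>B\<^sub>0 = \<pi> ` N\<close> in some
  finite quotient \<open>\<pi> : P \<rightarrow> B\<close>. Inducing \<open>K\<close> from \<open>B\<^sub>0\<close> to \<open>B\<close> gives a split extension of
  \<open>B\<close>, the twisted wreath product, and quasi-freeness of \<open>P\<close> lifts \<open>\<pi>\<close> to an epimorphism onto it.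
  Restrict the lift to \<open>N\<close> and evaluate the induced functions at \<open>\<one>\<close>. The result maps to \<open>H\<close> and lies
  over \<open>\<alpha>\<close>. It is surjective as soon as \<open>B\<^sub>0 \<noteq> B\<close>: the image of \<open>N\<close> contains all commutators of the
  wreath product, and those of a function supported on \<open>B\<^sub>0\<close> with an element outside \<open>B\<^sub>0\<close>
  already take every value of \<open>K\<close> at \<open>\<one>\<close>. This is \<open>normal_subgroup_proper_solution\<close>.

  At least \<open>m\<close> solutions. Let \<open>\<pi>\<close> vary over the \<open>m\<close> lifts of one quotient \<open>P \<rightarrow> A\<close> to epimorphisms
  \<open>P \<rightarrow> A \<times> C\<close> with \<open>C\<close> of order 3. The solution \<open>\<mu>\<close> obtained from \<open>\<pi>\<close> knows \<open>N \<cdot> ker \<pi>\<close>, as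
  the normalizer of \<open>ker \<mu>\<close> in \<open>P\<close>, and this subgroup leaves only finitely many possibilities for \<open>\<pi>\<close>.
  Hence \<open>\<pi> \<mapsto> \<mu>\<close> has finite fibres and \<open>m\<close> different solutions arise: \<open>card_proper_solutions_ge\<close>.

  At most \<open>m\<close> solutions. Each of them is a composition of an epimorphism from \<open>P\<close> onto a finite group,
  restricted to \<open>N\<close>, with a map between finite sets. Up to isomorphism there are countably many
  finite groups, and \<open>P\<close> has at most \<open>m\<close> epimorphisms onto each:
  \<open>card_of_continuous_homs_on_subgroup_le\<close>.
\<close>

section \<open>Topological and profinite groups\<close>

context topological_group
begin

lemma continuous_map_mult:
  assumes "continuous_map X T g" "continuous_map X T h"
  shows "continuous_map X T (\<lambda>x. g x \<otimes> h x)"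
proof -
  have "continuous_map X (prod_topology T T) (\<lambda>x. (g x, h x))"
    using assms by (simp add: continuous_map_pairedI)
  from continuous_map_compose[OF this continuous_mult] show ?thesis
    by (simp add: comp_def)
qed

lemma continuous_map_const_group:
  assumes "a \<in> carrier P"
  shows "continuous_map X T (\<lambda>x. a)"
  using assms by (simp add: topspace_eq)

lemma closure_of_subgroup:
  assumes "subgroup S P"
  shows "subgroup (T closure_of S) P"
proof
  interpret S: subgroup S P by fact
  have sub: "S \<subseteq> T closure_of S"
    using S.subset by (intro closure_of_subset) (simp add: topspace_eq)
  show "T closure_of S \<subseteq> carrier P"
    using closure_of_subset_topspace topspace_eq by metis
  show "\<one> \<in> T closure_of S"
    using sub S.one_closed by blast
  show "inv x \<in> T closure_of S" if "x \<in> T closure_of S" for x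
    using continuous_map_image_closure_subset[OF continuous_inv, of S] that
      closure_of_mono[of "(\<lambda>x. inv x) ` S" S T] by auto
  show "x \<otimes> y \<in> T closure_of S" if "x \<in> T closure_of S" "y \<in> T closure_of S" for x y
  proof -
    have "(\<lambda>(x, y). x \<otimes> y) ` (S \<times> S) \<subseteq> S" by auto
    moreover have "(x, y) \<in> prod_topology T T closure_of (S \<times> S)"
      using that by (simp add: closure_of_Times)
    ultimately show ?thesis
      using continuous_map_image_closure_subset[OF continuous_mult, of "S \<times> S"]
        closure_of_mono[of "(\<lambda>(x, y). x \<otimes> y) ` (S \<times> S)" S T] by fast
  qed
qed

lemma closure_of_normal:
  assumes "S \<lhd> P"
  shows "(T closure_of S) \<lhd> P"
proof (rule normal_invI)
  interpret S: normal S P by fact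
  show "subgroup (T closure_of S) P"
    by (rule closure_of_subgroup) (rule S.is_subgroup)
  show "x \<otimes> y \<otimes> inv x \<in> T closure_of S" if "y \<in> T closure_of S" "x \<in> carrier P" for y x
  proof -
    have "continuous_map T T (\<lambda>y. x \<otimes> y \<otimes> inv x)"
      using that(2) by (intro continuous_map_mult continuous_map_const_group) auto
    from continuous_map_image_closure_subset[OF this, of S] that(1)
    have "x \<otimes> y \<otimes> inv x \<in> T closure_of ((\<lambda>y. x \<otimes> y \<otimes> inv x) ` S)" by blast
    moreover have "(\<lambda>y. x \<otimes> y \<otimes> inv x) ` S \<subseteq> S"
      using S.inv_op_closed2 that(2) by auto
    ultimately show ?thesis using closure_of_mono by blast
  qed
qed

lemma subgroup_topological_group:
  assumes "subgroup S P"
  shows "topological_group (P\<lparr>carrier := S\<rparr>) (subtopology T S)"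
proof -
  interpret S: subgroup S P by fact
  have S: "S \<subseteq> topspace T" using S.subset topspace_eq by simp
  show ?thesis
  proof (intro topological_group.intro topological_group_axioms.intro)
    show "Group.group (P\<lparr>carrier := S\<rparr>)"
      using subgroup_imp_group assms by simp
    show "topspace (subtopology T S) = carrier (P\<lparr>carrier := S\<rparr>)"
      using S by auto
    have "continuous_map (subtopology (prod_topology T T) (S \<times> S)) (subtopology T S) (\<lambda>(x, y). x \<otimes> y)"
      using S by (auto simp: continuous_map_in_subtopology
          intro!: continuous_map_from_subtopology[OF continuous_mult])
    thus "continuous_map (prod_topology (subtopology T S) (subtopology T S)) (subtopology T S)
        (\<lambda>(x, y). x \<otimes>\<^bsub>P\<lparr>carrier := S\<rparr>\<^esub> y)"
      by (simp add: subtopology_Times)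
    have "continuous_map (subtopology T S) (subtopology T S) (\<lambda>x. inv x)"
      using S by (auto simp: continuous_map_in_subtopology
          intro!: continuous_map_from_subtopology[OF continuous_inv])
    thus "continuous_map (subtopology T S) (subtopology T S) (\<lambda>x. inv\<^bsub>P\<lparr>carrier := S\<rparr>\<^esub> x)"
      by (rule continuous_map_eq) (use m_inv_consistent[OF assms] in auto)
  qed
qed

text \<open>A map to a discrete space cannot gain values when passing to the closure. So a finite
  quotient sees no difference between the closed commutator subgroup and the abstract derived one.\<close>

lemma image_closure_of_discrete:
  assumes "continuous_map T (discrete_topology A) l" "S \<subseteq> carrier P"
  shows "l ` (T closure_of S) = l ` S"
proof
  have "l ` S \<subseteq> A"
    using assms continuous_map_image_subset_topspace[OF assms(1)] topspace_eq by auto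
  thus "l ` (T closure_of S) \<subseteq> l ` S"
    using continuous_map_image_closure_subset[OF assms(1), of S]
    by (simp add: discrete_topology_closure_of Int_absorb1)
  show "l ` S \<subseteq> l ` (T closure_of S)"
    using assms(2) closure_of_subset[of S T] topspace_eq by blast
qed

lemma closed_commutator_subgroup_normal: "closed_commutator_subgroup P T \<lhd> P"
  unfolding closed_commutator_subgroup_def
  by (intro closure_of_normal derived_self_is_normal)

lemma commutator_in_closed_commutator_subgroup:
  assumes "x \<in> carrier P" "y \<in> carrier P"
  shows "x \<otimes> y \<otimes> inv x \<otimes> inv y \<in> closed_commutator_subgroup P T"
proof -
  have "x \<otimes> y \<otimes> inv x \<otimes> inv y \<in> derived P (carrier P)"
    unfolding derived_def using assms by (intro generate.incl) blast
  moreover have "derived P (carrier P) \<subseteq> T closure_of derived P (carrier P)"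
    by (intro closure_of_subset) (simp add: topspace_eq derived_in_carrier)
  ultimately show ?thesis unfolding closed_commutator_subgroup_def by blast
qed

lemma closed_commutator_subgroup_in_kernel:
  assumes C: "comm_group C" and l: "l \<in> hom P C"
    and cont: "continuous_map T (discrete_topology (carrier C)) l"
    and x: "x \<in> closed_commutator_subgroup P T"
  shows "l x = \<one>\<^bsub>C\<^esub>"
proof -
  interpret C: comm_group C by fact
  interpret l: group_hom P C l by unfold_locales (rule l)
  have "l ` derived P (carrier P) = derived C (l ` carrier P)"
    using l.derived_img[of "carrier P"] by simp
  also have "\<dots> = {\<one>\<^bsub>C\<^esub>}"
    by (rule C.derived_eq_singleton) (use l.hom_closed in blast)
  finally have "l ` closed_commutator_subgroup P T = {\<one>\<^bsub>C\<^esub>}"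
    using image_closure_of_discrete[OF cont, of "derived P (carrier P)"]
    by (simp add: closed_commutator_subgroup_def derived_in_carrier)
  thus ?thesis using x by blast
qed

end

context profinite_group
begin

lemma closed_subgroup_profinite:
  assumes "subgroup S P" "closedin T S"
  shows "profinite_group (P\<lparr>carrier := S\<rparr>) (subtopology T S)"
proof (intro profinite_group.intro profinite_group_axioms.intro)
  show "topological_group (P\<lparr>carrier := S\<rparr>) (subtopology T S)"
    by (rule subgroup_topological_group) fact
  show "compact_space (subtopology T S)"
    using assms(2) compact by (simp add: closedin_compact_space compact_space_subtopology)
  show "Hausdorff_space (subtopology T S)"
    by (rule Hausdorff_space_subtopology) (rule Hausdorff)
  show "totally_disconnected_space (subtopology T S)"
    using totally_disconnected by (auto simp: totally_disconnected_space_def connectedin_subtopology)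
qed

text \<open>In a compact Hausdorff space two closed sets that no connected set joins are separated by a clopen
  set. Here connected sets have at most one point, so disjoint closed sets will do.\<close>

lemma clopen_neighbourhood:
  assumes "openin T U" "x \<in> U"
  obtains V where "openin T V" "closedin T V" "x \<in> V" "V \<subseteq> U"
proof -
  have x: "x \<in> topspace T" using assms openin_subset by blast
  have "separated_between T {x} (topspace T - U)"
  proof (rule cut_wire_fence_theorem)
    show "closedin T {x}" using x Hausdorff by (simp add: closedin_Hausdorff_sing_eq)
    show "closedin T (topspace T - U)" using assms(1) by blast
    show "disjnt C {x} \<or> disjnt C (topspace T - U)" if C: "connectedin T C" for C
    proof -
      obtain a where "C \<subseteq> {a}"
        using totally_disconnected C unfolding totally_disconnected_space_def by blast
      thus ?thesis using assms(2) by (auto simp: disjnt_iff)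
    qed
  qed (rule compact Hausdorff)+
  then obtain V where "openin T V" "closedin T V" "{x} \<subseteq> V" "topspace T - U \<subseteq> topspace T - V"
    unfolding separated_between by blast
  thus ?thesis using that[of V] openin_subset by blast
qed

text \<open>Profinite groups have arbitrarily small open normal subgroups. Take a clopen neighbourhood
  \<open>V\<close> of \<open>\<one>\<close> and let \<open>D\<close> be the kernel of its syntactic congruence, that is the set of all
  \<open>x\<close> that can be deleted from or inserted into any product \<open>a \<otimes> b\<close> without affecting membership
  in \<open>V\<close>. This is a normal subgroup by its very form, without first passing to a non-normal one,
  and it lies in \<open>V\<close> (put \<open>a = b = \<one>\<close>). It is open because its complement is the image of a
  closed subset of \<open>P \<times> P \<times> P\<close> under the projection along the compact factor \<open>P \<times> P\<close>.\<close>

theorem open_normal_subgroup_in_neighbourhood: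
  assumes "openin T U" "\<one> \<in> U"
  obtains D where "D \<lhd> P" "openin T D" "D \<subseteq> U"
proof -
  obtain V where V: "openin T V" "closedin T V" "\<one> \<in> V" "V \<subseteq> U"
    using clopen_neighbourhood[OF assms] .
  define D where "D = {x \<in> carrier P. \<forall>a\<in>carrier P. \<forall>b\<in>carrier P.
      a \<otimes> x \<otimes> b \<in> V \<longleftrightarrow> a \<otimes> b \<in> V}"
  have "D \<lhd> P"
  proof (rule normal_invI)
    show "subgroup D P"
    proof
      show "D \<subseteq> carrier P" "\<one> \<in> D" by (auto simp: D_def)
      show "x \<otimes> y \<in> D" if "x \<in> D" "y \<in> D" for x y
      proof -
        have "a \<otimes> (x \<otimes> y) \<otimes> b \<in> V \<longleftrightarrow> a \<otimes> b \<in> V" if "a \<in> carrier P" "b \<in> carrier P" for a b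
        proof -
          have "a \<otimes> (x \<otimes> y) \<otimes> b = a \<otimes> x \<otimes> (y \<otimes> b)" "a \<otimes> (y \<otimes> b) = a \<otimes> y \<otimes> b"
            using \<open>x \<in> D\<close> \<open>y \<in> D\<close> that by (auto simp: D_def m_assoc)
          thus ?thesis using \<open>x \<in> D\<close> \<open>y \<in> D\<close> that by (auto simp: D_def)
        qed
        thus ?thesis using \<open>x \<in> D\<close> \<open>y \<in> D\<close> by (auto simp: D_def)
      qed
      show "inv x \<in> D" if "x \<in> D" for x
      proof -
        have "a \<otimes> inv x \<otimes> b \<in> V \<longleftrightarrow> a \<otimes> b \<in> V" if "a \<in> carrier P" "b \<in> carrier P" for a b
        proof -
          have "a \<otimes> inv x \<otimes> x = a" "a \<otimes> inv x \<in> carrier P"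
            using \<open>x \<in> D\<close> that by (auto simp: D_def m_assoc)
          moreover have "a \<otimes> inv x \<otimes> x \<otimes> b \<in> V \<longleftrightarrow> a \<otimes> inv x \<otimes> b \<in> V"
            using \<open>x \<in> D\<close> \<open>a \<otimes> inv x \<in> carrier P\<close> that unfolding D_def by blast
          ultimately show ?thesis by simp
        qed
        thus ?thesis using \<open>x \<in> D\<close> by (auto simp: D_def)
      qed
    qed
    show "c \<otimes> x \<otimes> inv c \<in> D" if "x \<in> D" "c \<in> carrier P" for x c
    proof -
      have "a \<otimes> (c \<otimes> x \<otimes> inv c) \<otimes> b \<in> V \<longleftrightarrow> a \<otimes> b \<in> V"
        if "a \<in> carrier P" "b \<in> carrier P" for a b
      proof -
        have "a \<otimes> (c \<otimes> x \<otimes> inv c) \<otimes> b = (a \<otimes> c) \<otimes> x \<otimes> (inv c \<otimes> b)"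
             "(a \<otimes> c) \<otimes> (inv c \<otimes> b) = a \<otimes> b"
          using \<open>x \<in> D\<close> \<open>c \<in> carrier P\<close> that m_assoc[of c "inv c" b]
          by (auto simp: D_def m_assoc)
        thus ?thesis using \<open>x \<in> D\<close> \<open>c \<in> carrier P\<close> that by (auto simp: D_def)
      qed
      thus ?thesis using \<open>x \<in> D\<close> \<open>c \<in> carrier P\<close> by (auto simp: D_def)
    qed
  qed
  moreover have "openin T D"
  proof -
    let ?X = "prod_topology (prod_topology T T) T"
    define g where "g = (\<lambda>((a, b), x). a \<otimes> x \<otimes> b)"
    define h where "h = (\<lambda>((a, b), x :: 'a). a \<otimes> b)"
    have proj: "continuous_map ?X T (\<lambda>z. fst (fst z))" "continuous_map ?X T (\<lambda>z. snd (fst z))"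
        "continuous_map ?X T snd"
      using continuous_map_compose[OF continuous_map_fst continuous_map_fst]
        continuous_map_compose[OF continuous_map_fst continuous_map_snd]
      by (simp_all add: comp_def continuous_map_snd)
    have g: "continuous_map ?X T g" and h: "continuous_map ?X T h"
      unfolding g_def h_def split_beta by (intro continuous_map_mult proj)+
    define V' where "V' = topspace T - V"
    have V': "openin T V'" using V(2) by (auto simp: V'_def)
    let ?pre = "\<lambda>g W. {z \<in> topspace ?X. g z \<in> W}"
    define W where "W = (?pre g V \<inter> ?pre h V) \<union> (?pre g V' \<inter> ?pre h V')"
    have "openin ?X W"
      unfolding W_def
      by (intro openin_Un openin_Int openin_continuous_map_preimage[OF g] openin_continuous_map_preimage[OF h]
          V(1) V')
    hence "closedin ?X (topspace ?X - W)" by blast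
    moreover have "closed_map ?X T snd"
      by (rule closed_map_snd) (simp add: compact_space_prod_topology compact)
    ultimately have "closedin T (snd ` (topspace ?X - W))"
      unfolding closed_map_def by blast
    moreover have "D = topspace T - snd ` (topspace ?X - W)"
    proof -
      have "z \<in> W \<longleftrightarrow> (g z \<in> V \<longleftrightarrow> h z \<in> V)" if "z \<in> topspace ?X" for z
        using continuous_map_image_subset_topspace[OF g]
          continuous_map_image_subset_topspace[OF h] that
        by (auto simp: W_def V'_def)
      hence *: "((a, b), x) \<in> W \<longleftrightarrow> (a \<otimes> x \<otimes> b \<in> V \<longleftrightarrow> a \<otimes> b \<in> V)"
        if "a \<in> carrier P" "b \<in> carrier P" "x \<in> carrier P" for a b x
        using that by (auto simp: g_def h_def topspace_eq)
      show ?thesis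
      proof
        show "D \<subseteq> topspace T - snd ` (topspace ?X - W)"
          using * by (auto simp: D_def topspace_eq)
        show "topspace T - snd ` (topspace ?X - W) \<subseteq> D"
        proof
          fix x assume x: "x \<in> topspace T - snd ` (topspace ?X - W)"
          have "a \<otimes> x \<otimes> b \<in> V \<longleftrightarrow> a \<otimes> b \<in> V" if "a \<in> carrier P" "b \<in> carrier P" for a b
          proof -
            have "((a, b), x) \<notin> topspace ?X - W" using x by force
            thus ?thesis using x that * by (auto simp: topspace_eq)
          qed
          thus "x \<in> D" using x by (auto simp: D_def topspace_eq)
        qed
      qed
    qed
    ultimately show ?thesis by blast
  qed
  moreover have "D \<subseteq> U"
  proof
    fix x assume "x \<in> D"
    hence "x \<in> carrier P" "\<one> \<otimes> x \<otimes> \<one> \<in> V \<longleftrightarrow> \<one> \<otimes> \<one> \<in> V"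
      unfolding D_def by blast+
    thus "x \<in> U" using V by auto
  qed
  ultimately show ?thesis using that by blast
qed

lemma open_normal_quotient:
  assumes D: "D \<lhd> P" and "openin T D"
  shows "finite (carrier (P Mod D))" "(\<lambda>x. D #> x) \<in> epi P (P Mod D)"
    "continuous_map T (discrete_topology (carrier (P Mod D))) (\<lambda>x. D #> x)"
proof -
  interpret D: normal D P by fact
  have car: "carrier (P Mod D) = (\<lambda>x. D #> x) ` carrier P"
    by (auto simp: FactGroup_def RCOSETS_def)
  have op: "openin T (D #> x)" if x: "x \<in> carrier P" for x
  proof -
    have "continuous_map T T (\<lambda>y. y \<otimes> inv x)"
      using x by (intro continuous_map_mult continuous_map_const_group) auto
    from openin_continuous_map_preimage[OF this assms(2)]
    have "openin T {y \<in> carrier P. y \<otimes> inv x \<in> D}" by (simp add: topspace_eq)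
    also have "{y \<in> carrier P. y \<otimes> inv x \<in> D} = D #> x"
    proof
      show "{y \<in> carrier P. y \<otimes> inv x \<in> D} \<subseteq> D #> x"
        using D.rcos_module[OF is_group x] by auto
      show "D #> x \<subseteq> {y \<in> carrier P. y \<otimes> inv x \<in> D}"
        using D.rcos_module[OF is_group x] r_coset_subset_G[OF D.subset x] by auto
    qed
    finally show ?thesis .
  qed
  show "(\<lambda>x. D #> x) \<in> epi P (P Mod D)"
    using D.r_coset_hom_Mod car by (simp add: epi_def)
  show "continuous_map T (discrete_topology (carrier (P Mod D))) (\<lambda>x. D #> x)"
  proof -
    have "openin T {y \<in> topspace T. D #> y \<in> U}" for U
    proof (subst openin_subopen, intro ballI)
      fix y assume y: "y \<in> {y \<in> topspace T. D #> y \<in> U}"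
      have "D #> y \<subseteq> {y \<in> topspace T. D #> y \<in> U}"
      proof
        fix z assume z: "z \<in> D #> y"
        hence "D #> z = D #> y"
          using y D.is_subgroup repr_independence[of z D y] topspace_eq by auto
        moreover have "z \<in> carrier P" using z y r_coset_subset_G[OF D.subset] topspace_eq by auto
        ultimately show "z \<in> {y \<in> topspace T. D #> y \<in> U}"
          using y topspace_eq by auto
      qed
      moreover have "y \<in> D #> y"
        using y rcos_self[OF _ D.is_subgroup] topspace_eq by auto
      ultimately show "\<exists>W. openin T W \<and> y \<in> W \<and> W \<subseteq> {y \<in> topspace T. D #> y \<in> U}"
        using op y topspace_eq by blast
    qed
    thus ?thesis
      by (auto simp: continuous_map_def car topspace_eq)
  qed
  show "finite (carrier (P Mod D))"
  proof -
    have "compactin T (topspace T)" using compact by (simp add: compact_space_def)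
    moreover have "topspace T \<subseteq> \<Union>(carrier (P Mod D))"
      using rcos_self[OF _ D.is_subgroup] by (auto simp: car topspace_eq)
    moreover have "\<forall>U\<in>carrier (P Mod D). openin T U" using op car by auto
    ultimately obtain \<F> where \<F>: "finite \<F>" "\<F> \<subseteq> carrier (P Mod D)" "topspace T \<subseteq> \<Union>\<F>"
      unfolding compactin_def by meson
    have "carrier (P Mod D) \<subseteq> \<F>"
    proof
      fix X assume "X \<in> carrier (P Mod D)"
      then obtain x where x: "x \<in> carrier P" "X = D #> x" using car by auto
      then obtain Y where Y: "Y \<in> \<F>" "x \<in> Y" using \<F>(3) topspace_eq by blast
      then obtain y where y: "y \<in> carrier P" "Y = D #> y" using \<F>(2) car by auto
      hence "D #> y \<in> \<F>" "y \<in> carrier P" "x \<in> D #> y" using Y by simp_all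
      moreover have "D #> y = D #> x"
        by (rule repr_independence[OF \<open>x \<in> D #> y\<close> \<open>y \<in> carrier P\<close> D.is_subgroup])
      ultimately show "X \<in> \<F>" using x by simp
    qed
    thus ?thesis using \<F>(1) finite_subset by blast
  qed
qed

text \<open>The kernel of \<open>l\<close> is open in \<open>S\<close> only, so it is the trace of a neighbourhood of \<open>\<one>\<close> in \<open>P\<close>,
  which contains an open normal subgroup of \<open>P\<close>. This makes \<open>l\<close> visible in a finite quotient of
  the whole group although it need not extend to \<open>P\<close>.\<close>

lemma hom_on_subgroup_factors_mod_open_normal:
  assumes S: "subgroup S P" and l: "l \<in> hom (P\<lparr>carrier := S\<rparr>) A" and A: "Group.group A"
    and cont: "continuous_map (subtopology T S) (discrete_topology (carrier A)) l"
  obtains D where "D \<lhd> P" "openin T D" "\<And>x. x \<in> S \<Longrightarrow> x \<in> D \<Longrightarrow> l x = \<one>\<^bsub>A\<^esub>"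
proof -
  interpret S: subgroup S P by fact
  interpret A: Group.group A by fact
  have SG: "Group.group (P\<lparr>carrier := S\<rparr>)" using subgroup_imp_group S by simp
  have "l \<one> = \<one>\<^bsub>A\<^esub>" using hom_one[OF l SG A] by simp
  have "openin (discrete_topology (carrier A)) {\<one>\<^bsub>A\<^esub>}" by simp
  from openin_continuous_map_preimage[OF cont this]
  obtain U where U: "openin T U" "{x \<in> topspace (subtopology T S). l x \<in> {\<one>\<^bsub>A\<^esub>}} = U \<inter> S"
    unfolding openin_subtopology by blast
  have top: "topspace (subtopology T S) = S" using S.subset topspace_eq by auto
  have "\<one> \<in> U" using U(2) top \<open>l \<one> = \<one>\<^bsub>A\<^esub>\<close> S.one_closed by blast
  from open_normal_subgroup_in_neighbourhood[OF U(1) this]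
  obtain D where "D \<lhd> P" "openin T D" "D \<subseteq> U" .
  with U(2) top show ?thesis using that[of D] by blast
qed

end

section \<open>Twisted wreath products\<close>

text \<open>The problem to be solved lives on a normal subgroup. Its kernel \<open>K\<close> carries an action of a
  subgroup \<open>B\<^sub>0\<close> of a finite quotient \<open>B\<close> only, namely conjugation through \<open>\<rho>\<close>. Inducing \<open>K\<close> up to
  \<open>B\<close> gives a group on which all of \<open>B\<close> acts, and hence a split extension of \<open>B\<close>: the twisted
  wreath product.\<close>

locale twisted_wreath =
  B: Group.group B + H: Group.group H + B\<^sub>0: normal B\<^sub>0 B + K: normal K H
  for B :: "('b, 'c) monoid_scheme" and H :: "('h, 'd) monoid_scheme" and B\<^sub>0 and K +
  fixes \<rho> :: "'b \<Rightarrow> 'h"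
  assumes \<rho>_hom: "\<rho> \<in> hom (B\<lparr>carrier := B\<^sub>0\<rparr>) H"
begin

text \<open>The induced group: functions on \<open>B\<close> determined by one value in \<open>K\<close> on each left coset of \<open>B\<^sub>0\<close>.
  The equivariance condition replaces a choice of coset representatives.\<close>

definition base :: "('b \<Rightarrow> 'h) set" where
  "base = {F \<in> carrier B \<rightarrow>\<^sub>E K. \<forall>x\<in>carrier B. \<forall>z\<in>B\<^sub>0.
     F (x \<otimes>\<^bsub>B\<^esub> z) = inv\<^bsub>H\<^esub> (\<rho> z) \<otimes>\<^bsub>H\<^esub> F x \<otimes>\<^bsub>H\<^esub> \<rho> z}"

text \<open>The semidirect product of \<open>base\<close> and \<open>B\<close>, with \<open>B\<close> acting by translation of the argument. A
  pair \<open>(F, b)\<close> stands for the product \<open>b F\<close>; moving \<open>b'\<close> past \<open>F\<close> in \<open>b F b' F'\<close> translates \<open>F\<close>.\<close>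

definition wreath :: "(('b \<Rightarrow> 'h) \<times> 'b) monoid" where
  "wreath = \<lparr>carrier = base \<times> carrier B,
     monoid.mult = (\<lambda>(F, b) (F', b'). (\<lambda>x\<in>carrier B. F (b' \<otimes>\<^bsub>B\<^esub> x) \<otimes>\<^bsub>H\<^esub> F' x, b \<otimes>\<^bsub>B\<^esub> b')),
     one = (\<lambda>x\<in>carrier B. \<one>\<^bsub>H\<^esub>, \<one>\<^bsub>B\<^esub>)\<rparr>"

lemma carrier_wreath [simp]: "carrier wreath = base \<times> carrier B"
  and mult_wreath [simp]: "(F, b) \<otimes>\<^bsub>wreath\<^esub> (F', b') =
      (\<lambda>x\<in>carrier B. F (b' \<otimes>\<^bsub>B\<^esub> x) \<otimes>\<^bsub>H\<^esub> F' x, b \<otimes>\<^bsub>B\<^esub> b')"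
  and one_wreath [simp]: "\<one>\<^bsub>wreath\<^esub> = (\<lambda>x\<in>carrier B. \<one>\<^bsub>H\<^esub>, \<one>\<^bsub>B\<^esub>)"
  by (simp_all add: wreath_def)

lemma \<rho>_closed [simp]: "z \<in> B\<^sub>0 \<Longrightarrow> \<rho> z \<in> carrier H"
  using \<rho>_hom by (auto simp: hom_def)

lemma \<rho>_mult: "z \<in> B\<^sub>0 \<Longrightarrow> z' \<in> B\<^sub>0 \<Longrightarrow> \<rho> (z \<otimes>\<^bsub>B\<^esub> z') = \<rho> z \<otimes>\<^bsub>H\<^esub> \<rho> z'"
  using \<rho>_hom by (auto simp: hom_def)

lemma \<rho>_one: "\<rho> \<one>\<^bsub>B\<^esub> = \<one>\<^bsub>H\<^esub>"
  using hom_one[OF \<rho>_hom B.subgroup_imp_group[OF B\<^sub>0.is_subgroup] H.is_group] by simp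

lemma base_K: "F \<in> base \<Longrightarrow> x \<in> carrier B \<Longrightarrow> F x \<in> K"
  by (auto simp: base_def)

lemma base_closed [simp]: "F \<in> base \<Longrightarrow> x \<in> carrier B \<Longrightarrow> F x \<in> carrier H"
  using base_K K.subset by blast

lemma base_twist:
  "F \<in> base \<Longrightarrow> x \<in> carrier B \<Longrightarrow> z \<in> B\<^sub>0 \<Longrightarrow> F (x \<otimes>\<^bsub>B\<^esub> z) = inv\<^bsub>H\<^esub> (\<rho> z) \<otimes>\<^bsub>H\<^esub> F x \<otimes>\<^bsub>H\<^esub> \<rho> z"
  by (auto simp: base_def)

lemma base_extensional: "F \<in> base \<Longrightarrow> F \<in> extensional (carrier B)"
  by (simp add: base_def PiE_def)

lemma baseI:
  assumes "\<And>x. x \<in> carrier B \<Longrightarrow> F x \<in> K"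
    and "\<And>x z. x \<in> carrier B \<Longrightarrow> z \<in> B\<^sub>0 \<Longrightarrow>
      F (x \<otimes>\<^bsub>B\<^esub> z) = inv\<^bsub>H\<^esub> (\<rho> z) \<otimes>\<^bsub>H\<^esub> F x \<otimes>\<^bsub>H\<^esub> \<rho> z"
  shows "restrict F (carrier B) \<in> base"
  using assms by (auto simp: base_def)

lemma twist_mult:
  assumes "u \<in> carrier H" "v \<in> carrier H" "r \<in> carrier H"
  shows "(inv\<^bsub>H\<^esub> r \<otimes>\<^bsub>H\<^esub> u \<otimes>\<^bsub>H\<^esub> r) \<otimes>\<^bsub>H\<^esub> (inv\<^bsub>H\<^esub> r \<otimes>\<^bsub>H\<^esub> v \<otimes>\<^bsub>H\<^esub> r) = inv\<^bsub>H\<^esub> r \<otimes>\<^bsub>H\<^esub> (u \<otimes>\<^bsub>H\<^esub> v) \<otimes>\<^bsub>H\<^esub> r"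
proof -
  have "r \<otimes>\<^bsub>H\<^esub> (inv\<^bsub>H\<^esub> r \<otimes>\<^bsub>H\<^esub> (v \<otimes>\<^bsub>H\<^esub> r)) = v \<otimes>\<^bsub>H\<^esub> r"
    using assms H.m_assoc[of r "inv\<^bsub>H\<^esub> r" "v \<otimes>\<^bsub>H\<^esub> r"] by simp
  thus ?thesis using assms by (simp add: H.m_assoc)
qed

lemma twist_inv:
  assumes "u \<in> carrier H" "r \<in> carrier H"
  shows "inv\<^bsub>H\<^esub> (inv\<^bsub>H\<^esub> r \<otimes>\<^bsub>H\<^esub> u \<otimes>\<^bsub>H\<^esub> r) = inv\<^bsub>H\<^esub> r \<otimes>\<^bsub>H\<^esub> inv\<^bsub>H\<^esub> u \<otimes>\<^bsub>H\<^esub> r"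
  using assms by (simp add: H.inv_mult_group H.m_assoc)

lemma base_one: "(\<lambda>x\<in>carrier B. \<one>\<^bsub>H\<^esub>) \<in> base"
  by (rule baseI) auto

lemma base_shift_mult:
  assumes "F \<in> base" "F' \<in> base" "b \<in> carrier B"
  shows "(\<lambda>x\<in>carrier B. F (b \<otimes>\<^bsub>B\<^esub> x) \<otimes>\<^bsub>H\<^esub> F' x) \<in> base"
proof (rule baseI)
  show "F (b \<otimes>\<^bsub>B\<^esub> x) \<otimes>\<^bsub>H\<^esub> F' x \<in> K" if "x \<in> carrier B" for x
    using assms that base_K by (intro K.m_closed) auto
  show "F (b \<otimes>\<^bsub>B\<^esub> (x \<otimes>\<^bsub>B\<^esub> z)) \<otimes>\<^bsub>H\<^esub> F' (x \<otimes>\<^bsub>B\<^esub> z) =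
      inv\<^bsub>H\<^esub> \<rho> z \<otimes>\<^bsub>H\<^esub> (F (b \<otimes>\<^bsub>B\<^esub> x) \<otimes>\<^bsub>H\<^esub> F' x) \<otimes>\<^bsub>H\<^esub> \<rho> z"
    if "x \<in> carrier B" "z \<in> B\<^sub>0" for x z
  proof -
    have "F (b \<otimes>\<^bsub>B\<^esub> (x \<otimes>\<^bsub>B\<^esub> z)) = inv\<^bsub>H\<^esub> \<rho> z \<otimes>\<^bsub>H\<^esub> F (b \<otimes>\<^bsub>B\<^esub> x) \<otimes>\<^bsub>H\<^esub> \<rho> z"
      using base_twist[OF assms(1), of "b \<otimes>\<^bsub>B\<^esub> x" z] assms that by (simp add: B.m_assoc)
    thus ?thesis using base_twist[OF assms(2) that] assms that by (simp add: twist_mult)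
  qed
qed

lemma base_shift_inv:
  assumes "F \<in> base" "b \<in> carrier B"
  shows "(\<lambda>x\<in>carrier B. inv\<^bsub>H\<^esub> (F (b \<otimes>\<^bsub>B\<^esub> x))) \<in> base"
proof (rule baseI)
  show "inv\<^bsub>H\<^esub> F (b \<otimes>\<^bsub>B\<^esub> x) \<in> K" if "x \<in> carrier B" for x
    using assms that base_K by (intro K.m_inv_closed) auto
  show "inv\<^bsub>H\<^esub> F (b \<otimes>\<^bsub>B\<^esub> (x \<otimes>\<^bsub>B\<^esub> z)) = inv\<^bsub>H\<^esub> \<rho> z \<otimes>\<^bsub>H\<^esub> inv\<^bsub>H\<^esub> F (b \<otimes>\<^bsub>B\<^esub> x) \<otimes>\<^bsub>H\<^esub> \<rho> z"
    if "x \<in> carrier B" "z \<in> B\<^sub>0" for x z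
  proof -
    have "F (b \<otimes>\<^bsub>B\<^esub> (x \<otimes>\<^bsub>B\<^esub> z)) = inv\<^bsub>H\<^esub> \<rho> z \<otimes>\<^bsub>H\<^esub> F (b \<otimes>\<^bsub>B\<^esub> x) \<otimes>\<^bsub>H\<^esub> \<rho> z"
      using base_twist[OF assms(1), of "b \<otimes>\<^bsub>B\<^esub> x" z] assms that by (simp add: B.m_assoc)
    thus ?thesis using assms that by (simp add: twist_inv)
  qed
qed

lemma inverse_wreath:
  assumes "F \<in> base" "b \<in> carrier B"
  shows "(\<lambda>x\<in>carrier B. inv\<^bsub>H\<^esub> (F (inv\<^bsub>B\<^esub> b \<otimes>\<^bsub>B\<^esub> x)), inv\<^bsub>B\<^esub> b) \<otimes>\<^bsub>wreath\<^esub> (F, b) = \<one>\<^bsub>wreath\<^esub>"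
proof -
  have "inv\<^bsub>B\<^esub> b \<otimes>\<^bsub>B\<^esub> (b \<otimes>\<^bsub>B\<^esub> x) = x" if "x \<in> carrier B" for x
    using assms that B.m_assoc[of "inv\<^bsub>B\<^esub> b" b x] by simp
  thus ?thesis using assms by (auto simp: fun_eq_iff)
qed

lemma group_wreath: "Group.group wreath"
proof (rule groupI)
  show "\<one>\<^bsub>wreath\<^esub> \<in> carrier wreath" by (simp add: base_one)
  show "e \<otimes>\<^bsub>wreath\<^esub> e' \<in> carrier wreath" if "e \<in> carrier wreath" "e' \<in> carrier wreath" for e e'
    using that base_shift_mult by (cases e; cases e') auto
  show "e \<otimes>\<^bsub>wreath\<^esub> e' \<otimes>\<^bsub>wreath\<^esub> e'' = e \<otimes>\<^bsub>wreath\<^esub> (e' \<otimes>\<^bsub>wreath\<^esub> e'')"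
    if "e \<in> carrier wreath" "e' \<in> carrier wreath" "e'' \<in> carrier wreath" for e e' e''
    using that by (cases e; cases e'; cases e'') (simp add: B.m_assoc H.m_assoc cong: restrict_cong)
  show "\<one>\<^bsub>wreath\<^esub> \<otimes>\<^bsub>wreath\<^esub> e = e" if eW: "e \<in> carrier wreath" for e
  proof -
    obtain F b where e: "e = (F, b)" "F \<in> base" "b \<in> carrier B"
      using eW by auto
    have "(\<lambda>x\<in>carrier B. F x) = F" using base_extensional[OF e(2)] by (rule extensional_restrict)
    moreover have "(\<lambda>x\<in>carrier B. (\<lambda>x\<in>carrier B. \<one>\<^bsub>H\<^esub>) (b \<otimes>\<^bsub>B\<^esub> x) \<otimes>\<^bsub>H\<^esub> F x) = (\<lambda>x\<in>carrier B. F x)"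
      using e by (intro restrict_ext) simp
    ultimately show ?thesis using e by simp
  qed
  show "\<exists>e'\<in>carrier wreath. e' \<otimes>\<^bsub>wreath\<^esub> e = \<one>\<^bsub>wreath\<^esub>" if eW: "e \<in> carrier wreath" for e
  proof -
    obtain F b where e: "e = (F, b)" "F \<in> base" "b \<in> carrier B"
      using eW by auto
    have "(\<lambda>x\<in>carrier B. inv\<^bsub>H\<^esub> (F (inv\<^bsub>B\<^esub> b \<otimes>\<^bsub>B\<^esub> x)), inv\<^bsub>B\<^esub> b) \<in> carrier wreath"
      using base_shift_inv[OF e(2), of "inv\<^bsub>B\<^esub> b"] e(3) by simp
    with inverse_wreath[OF e(2,3)] show ?thesis unfolding e(1) by (rule bexI)
  qed
qed

sublocale W: Group.group wreath
  by (rule group_wreath)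

lemma inv_wreath:
  assumes "F \<in> base" "b \<in> carrier B"
  shows "inv\<^bsub>wreath\<^esub> (F, b) = (\<lambda>x\<in>carrier B. inv\<^bsub>H\<^esub> (F (inv\<^bsub>B\<^esub> b \<otimes>\<^bsub>B\<^esub> x)), inv\<^bsub>B\<^esub> b)"
  using assms base_shift_inv[OF assms(1), of "inv\<^bsub>B\<^esub> b"]
  by (intro W.inv_equality inverse_wreath) auto

lemma finite_wreath:
  assumes "finite (carrier B)" "finite K"
  shows "finite (carrier wreath)"
proof -
  have "base \<subseteq> carrier B \<rightarrow>\<^sub>E K" by (auto simp: base_def)
  thus ?thesis using assms finite_subset finite_PiE by (metis carrier_wreath finite_cartesian_product)
qed

lemma snd_epi: "snd \<in> epi wreath B"
proof -
  have "snd ` carrier wreath = carrier B" using base_one by force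
  moreover have "snd \<in> hom wreath B" by (rule homI) auto
  ultimately show ?thesis by (simp add: epi_def)
qed

lemma section_hom: "(\<lambda>b. (\<lambda>x\<in>carrier B. \<one>\<^bsub>H\<^esub>, b)) \<in> hom B wreath"
  by (rule homI) (simp_all add: base_one cong: restrict_cong)

text \<open>The element of \<open>base\<close> that is supported on the coset of \<open>t\<close> and takes the value \<open>k\<close> at \<open>t\<close>.\<close>

definition delta :: "'b \<Rightarrow> 'h \<Rightarrow> 'b \<Rightarrow> 'h" where
  "delta t k = (\<lambda>y\<in>carrier B. if inv\<^bsub>B\<^esub> t \<otimes>\<^bsub>B\<^esub> y \<in> B\<^sub>0
     then inv\<^bsub>H\<^esub> (\<rho> (inv\<^bsub>B\<^esub> t \<otimes>\<^bsub>B\<^esub> y)) \<otimes>\<^bsub>H\<^esub> k \<otimes>\<^bsub>H\<^esub> \<rho> (inv\<^bsub>B\<^esub> t \<otimes>\<^bsub>B\<^esub> y) else \<one>\<^bsub>H\<^esub>)"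

lemma delta_base:
  assumes t: "t \<in> carrier B" and k: "k \<in> K"
  shows "delta t k \<in> base"
  unfolding delta_def
proof (rule baseI)
  have kH: "k \<in> carrier H" using k K.subset by blast
  let ?d = "\<lambda>y. if inv\<^bsub>B\<^esub> t \<otimes>\<^bsub>B\<^esub> y \<in> B\<^sub>0
     then inv\<^bsub>H\<^esub> (\<rho> (inv\<^bsub>B\<^esub> t \<otimes>\<^bsub>B\<^esub> y)) \<otimes>\<^bsub>H\<^esub> k \<otimes>\<^bsub>H\<^esub> \<rho> (inv\<^bsub>B\<^esub> t \<otimes>\<^bsub>B\<^esub> y) else \<one>\<^bsub>H\<^esub>"
  show "?d x \<in> K" if "x \<in> carrier B" for x
    using K.inv_op_closed1[OF _ k] K.one_closed by simp
  show "?d (x \<otimes>\<^bsub>B\<^esub> z) = inv\<^bsub>H\<^esub> \<rho> z \<otimes>\<^bsub>H\<^esub> ?d x \<otimes>\<^bsub>H\<^esub> \<rho> z"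
    if x: "x \<in> carrier B" and z: "z \<in> B\<^sub>0" for x z
  proof -
    define w where "w = inv\<^bsub>B\<^esub> t \<otimes>\<^bsub>B\<^esub> x"
    have w: "w \<in> carrier B" using x t by (simp add: w_def)
    have zB: "z \<in> carrier B" using z B\<^sub>0.subset by blast
    have wz: "inv\<^bsub>B\<^esub> t \<otimes>\<^bsub>B\<^esub> (x \<otimes>\<^bsub>B\<^esub> z) = w \<otimes>\<^bsub>B\<^esub> z"
      using x t zB by (simp add: w_def B.m_assoc)
    have "w \<otimes>\<^bsub>B\<^esub> z \<in> B\<^sub>0 \<longleftrightarrow> w \<in> B\<^sub>0"
    proof
      assume "w \<otimes>\<^bsub>B\<^esub> z \<in> B\<^sub>0"
      hence "w \<otimes>\<^bsub>B\<^esub> z \<otimes>\<^bsub>B\<^esub> inv\<^bsub>B\<^esub> z \<in> B\<^sub>0"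
        by (rule B\<^sub>0.m_closed[OF _ B\<^sub>0.m_inv_closed[OF z]])
      thus "w \<in> B\<^sub>0" using w zB by (simp add: B.m_assoc)
    qed (use z in blast)
    moreover have "inv\<^bsub>H\<^esub> (\<rho> (w \<otimes>\<^bsub>B\<^esub> z)) \<otimes>\<^bsub>H\<^esub> k \<otimes>\<^bsub>H\<^esub> \<rho> (w \<otimes>\<^bsub>B\<^esub> z) =
        inv\<^bsub>H\<^esub> \<rho> z \<otimes>\<^bsub>H\<^esub> (inv\<^bsub>H\<^esub> \<rho> w \<otimes>\<^bsub>H\<^esub> k \<otimes>\<^bsub>H\<^esub> \<rho> w) \<otimes>\<^bsub>H\<^esub> \<rho> z" if "w \<in> B\<^sub>0"
      using z kH that \<rho>_mult[OF that z] by (simp add: H.inv_mult_group H.m_assoc)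
    ultimately show ?thesis
      unfolding wz w_def[symmetric] using z by simp
  qed
qed

lemma delta_self:
  assumes "t \<in> carrier B" "k \<in> K"
  shows "delta t k t = k"
  using assms K.subset by (auto simp: delta_def \<rho>_one)

lemma delta_outside:
  assumes "y \<in> carrier B" "inv\<^bsub>B\<^esub> t \<otimes>\<^bsub>B\<^esub> y \<notin> B\<^sub>0"
  shows "delta t k y = \<one>\<^bsub>H\<^esub>"
  using assms by (simp add: delta_def)

text \<open>Commuting an element of the base with an element of \<open>B\<close> yields the quotient of its values at
  different places. With \<open>F = delta t k\<close> and \<open>b\<close> moving \<open>t\<close> out of its coset, nothing is lost at
  \<open>t\<close>: this is what makes the commutator subgroup of the wreath product large.\<close>

lemma base_commutator:
  assumes F: "F \<in> base" and b: "b \<in> carrier B"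
  shows "(\<lambda>x\<in>carrier B. \<one>\<^bsub>H\<^esub>, inv\<^bsub>B\<^esub> b) \<otimes>\<^bsub>wreath\<^esub> inv\<^bsub>wreath\<^esub> (F, \<one>\<^bsub>B\<^esub>)
      \<otimes>\<^bsub>wreath\<^esub> inv\<^bsub>wreath\<^esub> (\<lambda>x\<in>carrier B. \<one>\<^bsub>H\<^esub>, inv\<^bsub>B\<^esub> b)
      \<otimes>\<^bsub>wreath\<^esub> inv\<^bsub>wreath\<^esub> (inv\<^bsub>wreath\<^esub> (F, \<one>\<^bsub>B\<^esub>))
    = (\<lambda>x\<in>carrier B. inv\<^bsub>H\<^esub> (F (b \<otimes>\<^bsub>B\<^esub> x)) \<otimes>\<^bsub>H\<^esub> F x, \<one>\<^bsub>B\<^esub>)"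
proof -
  have "inv\<^bsub>wreath\<^esub> (inv\<^bsub>wreath\<^esub> (F, \<one>\<^bsub>B\<^esub>)) = (F, \<one>\<^bsub>B\<^esub>)"
    using F by (intro W.inv_inv) simp
  moreover have "inv\<^bsub>wreath\<^esub> (\<lambda>x\<in>carrier B. \<one>\<^bsub>H\<^esub>, inv\<^bsub>B\<^esub> b) = (\<lambda>x\<in>carrier B. \<one>\<^bsub>H\<^esub>, b)"
    using b base_one by (subst inv_wreath) (auto simp: fun_eq_iff)
  moreover have "inv\<^bsub>wreath\<^esub> (F, \<one>\<^bsub>B\<^esub>) = (\<lambda>x\<in>carrier B. inv\<^bsub>H\<^esub> (F x), \<one>\<^bsub>B\<^esub>)"
    using F by (subst inv_wreath) (auto simp: fun_eq_iff)
  ultimately show ?thesis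
    using F b by (auto simp: fun_eq_iff)
qed

lemma conjugate_base:
  assumes F: "F \<in> base" and L: "L \<in> base" "b \<in> carrier B"
  shows "(L, b) \<otimes>\<^bsub>wreath\<^esub> (F, \<one>\<^bsub>B\<^esub>) \<otimes>\<^bsub>wreath\<^esub> inv\<^bsub>wreath\<^esub> (L, b) =
    (\<lambda>x\<in>carrier B. L (inv\<^bsub>B\<^esub> b \<otimes>\<^bsub>B\<^esub> x) \<otimes>\<^bsub>H\<^esub> F (inv\<^bsub>B\<^esub> b \<otimes>\<^bsub>B\<^esub> x) \<otimes>\<^bsub>H\<^esub> inv\<^bsub>H\<^esub> (L (inv\<^bsub>B\<^esub> b \<otimes>\<^bsub>B\<^esub> x)), \<one>\<^bsub>B\<^esub>)"
  using assms by (simp add: inv_wreath cong: restrict_cong)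

text \<open>Evaluation at \<open>\<one>\<close>, the map behind Shapiro's lemma. It is a homomorphism only on the part lying
  over \<open>B\<^sub>0\<close>, where it turns the induced group back into \<open>K\<close>.\<close>

definition shapiro :: "('b \<Rightarrow> 'h) \<times> 'b \<Rightarrow> 'h" where
  "shapiro = (\<lambda>(F, b). \<rho> b \<otimes>\<^bsub>H\<^esub> F \<one>\<^bsub>B\<^esub>)"

lemma shapiro_closed:
  assumes "e \<in> base \<times> B\<^sub>0"
  shows "shapiro e \<in> carrier H"
  using assms by (auto simp: shapiro_def)

lemma shapiro_mult:
  assumes "e \<in> base \<times> B\<^sub>0" "e' \<in> base \<times> B\<^sub>0"
  shows "shapiro (e \<otimes>\<^bsub>wreath\<^esub> e') = shapiro e \<otimes>\<^bsub>H\<^esub> shapiro e'"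
proof -
  obtain F b F' b' where e: "e = (F, b)" "e' = (F', b')" "F \<in> base" "F' \<in> base" "b \<in> B\<^sub>0" "b' \<in> B\<^sub>0"
    using assms by auto
  have b': "b' \<in> carrier B" using e B\<^sub>0.subset by blast
  have "F b' = inv\<^bsub>H\<^esub> \<rho> b' \<otimes>\<^bsub>H\<^esub> F \<one>\<^bsub>B\<^esub> \<otimes>\<^bsub>H\<^esub> \<rho> b'"
    using base_twist[OF e(3) B.one_closed e(6)] b' by simp
  moreover have "\<rho> b' \<otimes>\<^bsub>H\<^esub> (inv\<^bsub>H\<^esub> \<rho> b' \<otimes>\<^bsub>H\<^esub> y) = y" if "y \<in> carrier H" for y
    using e that H.m_assoc[of "\<rho> b'" "inv\<^bsub>H\<^esub> \<rho> b'" y] by simp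
  ultimately show ?thesis
    using e b' by (simp add: shapiro_def \<rho>_mult H.m_assoc)
qed

lemma subgroup_shapiro_domain: "subgroup (base \<times> B\<^sub>0) wreath"
proof
  show "base \<times> B\<^sub>0 \<subseteq> carrier wreath" using B\<^sub>0.subset by auto
  show "\<one>\<^bsub>wreath\<^esub> \<in> base \<times> B\<^sub>0" using base_one by simp
  show "e \<otimes>\<^bsub>wreath\<^esub> e' \<in> base \<times> B\<^sub>0" if "e \<in> base \<times> B\<^sub>0" "e' \<in> base \<times> B\<^sub>0" for e e'
    using that base_shift_mult B\<^sub>0.subset by auto
  show "inv\<^bsub>wreath\<^esub> e \<in> base \<times> B\<^sub>0" if "e \<in> base \<times> B\<^sub>0" for e
    using that base_shift_inv B\<^sub>0.subset B\<^sub>0.m_inv_closed by (auto simp: inv_wreath)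
qed

lemma shapiro_base: "F \<in> base \<Longrightarrow> shapiro (F, \<one>\<^bsub>B\<^esub>) = F \<one>\<^bsub>B\<^esub>"
  by (simp add: shapiro_def \<rho>_one)

end

section \<open>Solving split embedding problems on a normal subgroup\<close>

lemma infinite_if_ordIso_Cinfinite:
  assumes "Cinfinite m" "|A| =o m"
  shows "infinite A"
  using assms card_of_ordIso_finite_Field[of m A] ordIso_symmetric unfolding cinfinite_def by blast

text \<open>The heart of the argument. Let \<open>N\<close> be normal and contain all commutators, and let \<open>\<pi>\<close> map \<open>P\<close> onto
  a finite group \<open>B\<close> such that \<open>\<alpha>\<close> factors through \<open>B\<^sub>0 = \<pi> ` N\<close>. The split embedding problem of the
  twisted wreath product over \<open>B\<close> has a solution \<open>l\<close>, and \<open>\<mu> = shapiro \<circ> l\<close> on \<open>N\<close> solves the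
  given problem. It is onto because \<open>l\<close> maps \<open>N\<close> onto a group containing all commutators of the
  wreath product, and by \<open>base_commutator\<close> these take all values of \<open>K\<close> at \<open>\<one>\<close>.

  The second claim says that \<open>\<mu>\<close> remembers the subgroup \<open>N \<cdot> ker \<pi>\<close>, as the normalizer of its
  kernel. Conjugation by \<open>p\<close> changes evaluation at \<open>\<one>\<close> into evaluation at \<open>(\<pi> p)\<^sup>-\<^sup>1\<close>. If these two
  places lie in different cosets of \<open>B\<^sub>0\<close> there is a commutator that is trivial at the first but not
  at the second; for this a third coset is needed, which the hypothesis \<open>index\<close> provides.\<close>

lemma (in profinite_group) normal_subgroup_proper_solution:
  assumes qf: "quasi_free P T m" and m: "Cinfinite m"
    and N: "N \<lhd> P"
    and comm: "\<And>x y. x \<in> carrier P \<Longrightarrow> y \<in> carrier P \<Longrightarrow> x \<otimes> y \<otimes> inv x \<otimes> inv y \<in> N"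
    and ep: "finite_split_embedding_problem (P\<lparr>carrier := N\<rparr>) (subtopology T N) G H \<alpha> f s"
    and nt: "nontrivial_embedding_problem G H f"
    and B: "Group.group B" "finite (carrier B)"
    and \<pi>: "\<pi> \<in> epi P B" "continuous_map T (discrete_topology (carrier B)) \<pi>"
    and ker: "\<And>n. n \<in> N \<Longrightarrow> \<pi> n = \<one>\<^bsub>B\<^esub> \<Longrightarrow> \<alpha> n = \<one>\<^bsub>G\<^esub>"
    and index: "\<And>t. t \<in> carrier B \<Longrightarrow> \<exists>b\<in>carrier B. b \<notin> \<pi> ` N \<and> t \<otimes>\<^bsub>B\<^esub> b \<notin> \<pi> ` N"
  obtains \<mu> where "\<mu> \<in> proper_solutions (P\<lparr>carrier := N\<rparr>) (subtopology T N) H \<alpha> f"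
    and "{p \<in> carrier P. \<forall>n\<in>N. \<mu> n = \<one>\<^bsub>H\<^esub> \<longrightarrow> \<mu> (p \<otimes> n \<otimes> inv p) = \<one>\<^bsub>H\<^esub>}
      = {p \<in> carrier P. \<pi> p \<in> \<pi> ` N}"
proof -
  interpret N: normal N P by fact
  interpret ep: finite_split_embedding_problem "P\<lparr>carrier := N\<rparr>" "subtopology T N" G H \<alpha> f s
    by fact
  interpret B: Group.group B by fact
  interpret G: Group.group G by (rule ep.group_G)
  interpret H: Group.group H by (rule ep.group_H)
  have \<pi>_hom: "\<pi> \<in> hom P B" and \<pi>_surj: "\<pi> ` carrier P = carrier B"
    using \<pi>(1) by (auto simp: epi_def)
  interpret \<pi>: group_hom P B \<pi> by unfold_locales (rule \<pi>_hom)
  have f_hom: "f \<in> hom H G" and f_surj: "f ` carrier H = carrier G"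
    using ep.f_epi by (auto simp: epi_def)
  interpret f: group_hom H G f by unfold_locales (rule f_hom)
  interpret s: group_hom G H s by unfold_locales (rule ep.s_hom)
  have \<alpha>_hom: "\<alpha> \<in> hom (P\<lparr>carrier := N\<rparr>) G" and \<alpha>_surj: "\<alpha> ` N = carrier G"
    using ep.alpha_epi by (auto simp: epi_def)
  interpret \<alpha>: group_hom "P\<lparr>carrier := N\<rparr>" G \<alpha>
    using subgroup_imp_group[OF N.is_subgroup] \<alpha>_hom
    by (intro group_hom.intro group_hom_axioms.intro) (simp_all add: G.is_group)
  have \<alpha>_closed: "\<alpha> n \<in> carrier G" if "n \<in> N" for n
    using \<alpha>.hom_closed[of n] that by simp
  have \<alpha>_mult: "\<alpha> (n \<otimes> n') = \<alpha> n \<otimes>\<^bsub>G\<^esub> \<alpha> n'" if "n \<in> N" "n' \<in> N" for n n'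
    using \<alpha>.hom_mult[of n n'] that by simp
  have \<alpha>_eq: "\<alpha> n = \<alpha> n'" if "n \<in> N" "n' \<in> N" "\<pi> n = \<pi> n'" for n n'
  proof -
    have "\<pi> (n \<otimes> inv n') = \<one>\<^bsub>B\<^esub>" using that N.subset by auto
    hence "\<alpha> (n \<otimes> inv n') = \<one>\<^bsub>G\<^esub>" using that by (intro ker) auto
    moreover have "\<alpha> (n \<otimes> inv n') \<otimes>\<^bsub>G\<^esub> \<alpha> n' = \<alpha> (n \<otimes> inv n' \<otimes> n')"
      using \<alpha>_mult that by simp
    moreover have "n \<otimes> inv n' \<otimes> n' = n" using that N.subset by (simp add: m_assoc subsetD)
    ultimately show ?thesis using \<alpha>_closed that by simp
  qed

  define K where "K = kernel H G f"
  have K_iff: "x \<in> K \<longleftrightarrow> x \<in> carrier H \<and> f x = \<one>\<^bsub>G\<^esub>" for x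
    by (simp add: K_def kernel_def)
  \<comment> \<open>\<open>\<rho>\<close> is \<open>s \<circ> \<alpha>\<close> read as a map on \<open>\<pi> ` N\<close>; it does not depend on the chosen preimages
    since \<open>\<alpha>\<close> factors through \<open>\<pi>\<close>.\<close>
  define \<rho> where "\<rho> = (\<lambda>z. s (\<alpha> (inv_into N \<pi> z)))"
  have \<rho>: "\<rho> (\<pi> n) = s (\<alpha> n)" if "n \<in> N" for n
  proof -
    have "inv_into N \<pi> (\<pi> n) \<in> N" "\<pi> (inv_into N \<pi> (\<pi> n)) = \<pi> n"
      using that by (auto intro: inv_into_into f_inv_into_f)
    thus ?thesis unfolding \<rho>_def using \<alpha>_eq that by metis
  qed
  have \<rho>_hom: "\<rho> \<in> hom (B\<lparr>carrier := \<pi> ` N\<rparr>) H"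
  proof (rule homI)
    fix z assume "z \<in> carrier (B\<lparr>carrier := \<pi> ` N\<rparr>)"
    then obtain n where n: "n \<in> N" "z = \<pi> n" by auto
    thus "\<rho> z \<in> carrier H" using \<rho> \<alpha>_closed by simp
    fix z' assume "z' \<in> carrier (B\<lparr>carrier := \<pi> ` N\<rparr>)"
    then obtain n' where n': "n' \<in> N" "z' = \<pi> n'" by auto
    have "z \<otimes>\<^bsub>B\<^esub> z' = \<pi> (n \<otimes> n')" using n n' N.subset by auto
    hence "\<rho> (z \<otimes>\<^bsub>B\<^esub> z') = s (\<alpha> (n \<otimes> n'))"
      using \<rho>[OF N.m_closed[OF n(1) n'(1)]] by metis
    thus "\<rho> (z \<otimes>\<^bsub>B\<lparr>carrier := \<pi> ` N\<rparr>\<^esub> z') = \<rho> z \<otimes>\<^bsub>H\<^esub> \<rho> z'"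
      using n n' \<rho> \<alpha>_mult \<alpha>_closed by simp
  qed
  have B\<^sub>0: "\<pi> ` N \<lhd> B"
    by (rule N.surj_hom_normal_subgroup[OF \<pi>.group_hom_axioms \<pi>_surj])
  interpret B\<^sub>0: normal "\<pi> ` N" B by (rule B\<^sub>0)
  interpret K: normal K H unfolding K_def by (rule f.normal_kernel)
  interpret W: twisted_wreath B H "\<pi> ` N" K \<rho>
    by (intro twisted_wreath.intro twisted_wreath_axioms.intro B.is_group H.is_group B\<^sub>0
        K.normal_axioms \<rho>_hom)
  let ?one = "\<lambda>x\<in>carrier B. \<one>\<^bsub>H\<^esub>"

  obtain k where k: "k \<in> K" "k \<noteq> \<one>\<^bsub>H\<^esub>"
    using nt K.one_closed unfolding nontrivial_embedding_problem_def K_def by blast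
  have "finite K" using ep.finite_H K.subset finite_subset by blast
  have wep: "finite_split_embedding_problem P T B W.wreath \<pi> snd (\<lambda>b. (?one, b))"
    by (intro finite_split_embedding_problem.intro B W.group_wreath W.finite_wreath \<open>finite K\<close>
        \<pi> W.snd_epi W.section_hom) simp
  have wnt: "nontrivial_embedding_problem B W.wreath snd"
  proof -
    have "(W.delta \<one>\<^bsub>B\<^esub> k, \<one>\<^bsub>B\<^esub>) \<in> kernel W.wreath B snd"
      using k by (simp add: kernel_def W.delta_base)
    moreover have "W.delta \<one>\<^bsub>B\<^esub> k \<one>\<^bsub>B\<^esub> \<noteq> ?one \<one>\<^bsub>B\<^esub>"
      using W.delta_self[of "\<one>\<^bsub>B\<^esub>" k] k by simp
    hence "W.delta \<one>\<^bsub>B\<^esub> k \<noteq> ?one" by metis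
    ultimately show ?thesis
      unfolding nontrivial_embedding_problem_def by (metis W.one_wreath prod.inject singletonD)
  qed
  have "|proper_solutions P T W.wreath \<pi> snd| =o m"
    by (rule quasi_free_proper_solutions[OF qf wep wnt])
  hence "proper_solutions P T W.wreath \<pi> snd \<noteq> {}"
    using infinite_if_ordIso_Cinfinite[OF m] by force
  then obtain l where l: "l \<in> proper_solutions P T W.wreath \<pi> snd" by blast
  hence l_epi: "l \<in> epi P W.wreath"
    and l_cont: "continuous_map T (discrete_topology (carrier W.wreath)) l"
    and snd_l: "\<And>x. x \<in> carrier P \<Longrightarrow> snd (l x) = \<pi> x"
    by (auto simp: proper_solutions_def)
  have l_hom: "l \<in> hom P W.wreath" and l_surj: "l ` carrier P = carrier W.wreath"
    using l_epi by (auto simp: epi_def)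
  interpret l: group_hom P W.wreath l by unfold_locales (rule l_hom)
  have l_pair: "l p = (fst (l p), \<pi> p)" "fst (l p) \<in> W.base" if "p \<in> carrier P" for p
  proof -
    show "l p = (fst (l p), \<pi> p)" using snd_l[OF that] by (metis prod.collapse)
    show "fst (l p) \<in> W.base" using l.hom_closed[OF that] W.carrier_wreath by (metis mem_Times_iff)
  qed
  have l_N: "l n \<in> W.base \<times> \<pi> ` N" if "n \<in> N" for n
  proof -
    have "n \<in> carrier P" using that N.subset by blast
    thus ?thesis using l_pair[of n] that by (metis SigmaI imageI)
  qed

  have commutator: "\<exists>n\<in>N. l n = (\<lambda>x\<in>carrier B. inv\<^bsub>H\<^esub> (F (b \<otimes>\<^bsub>B\<^esub> x)) \<otimes>\<^bsub>H\<^esub> F x, \<one>\<^bsub>B\<^esub>)"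
    if F: "F \<in> W.base" and b: "b \<in> carrier B" for F b
  proof -
    have "(?one, inv\<^bsub>B\<^esub> b) \<in> carrier W.wreath" using b W.base_one by simp
    then obtain p where p: "p \<in> carrier P" "l p = (?one, inv\<^bsub>B\<^esub> b)"
      using l_surj by (metis imageE)
    have "inv\<^bsub>W.wreath\<^esub> (F, \<one>\<^bsub>B\<^esub>) \<in> carrier W.wreath"
      using F by (intro W.W.inv_closed) simp
    then obtain q where q: "q \<in> carrier P" "l q = inv\<^bsub>W.wreath\<^esub> (F, \<one>\<^bsub>B\<^esub>)"
      using l_surj by (metis imageE)
    have "l (p \<otimes> q \<otimes> inv p \<otimes> inv q) = (\<lambda>x\<in>carrier B. inv\<^bsub>H\<^esub> (F (b \<otimes>\<^bsub>B\<^esub> x)) \<otimes>\<^bsub>H\<^esub> F x, \<one>\<^bsub>B\<^esub>)"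
      using W.base_commutator[OF F b] p q by simp
    thus ?thesis using comm[OF p(1) q(1)] by blast
  qed

  define \<mu> where "\<mu> = (\<lambda>n\<in>N. W.shapiro (l n))"
  have \<mu>_closed: "\<mu> n \<in> carrier H" if "n \<in> N" for n
    using l_N[OF that] that by (simp add: \<mu>_def W.shapiro_closed)
  have \<mu>_mult: "\<mu> (n \<otimes> n') = \<mu> n \<otimes>\<^bsub>H\<^esub> \<mu> n'" if "n \<in> N" "n' \<in> N" for n n'
  proof -
    have "l (n \<otimes> n') = l n \<otimes>\<^bsub>W.wreath\<^esub> l n'" using that N.subset by auto
    thus ?thesis using l_N that by (simp add: \<mu>_def W.shapiro_mult)
  qed
  have f_\<mu>: "f (\<mu> n) = \<alpha> n" if n: "n \<in> N" for n
  proof -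
    have nP: "n \<in> carrier P" using n N.subset by blast
    obtain F where F: "l n = (F, \<pi> n)" "F \<in> W.base"
      by (rule that[OF l_pair[OF nP]])
    have "F \<one>\<^bsub>B\<^esub> \<in> K" using F W.base_K by simp
    hence F1: "F \<one>\<^bsub>B\<^esub> \<in> carrier H" "f (F \<one>\<^bsub>B\<^esub>) = \<one>\<^bsub>G\<^esub>" unfolding K_iff by blast+
    have "\<mu> n = s (\<alpha> n) \<otimes>\<^bsub>H\<^esub> F \<one>\<^bsub>B\<^esub>"
      using F(1) n \<rho>[OF n] by (simp add: \<mu>_def W.shapiro_def)
    thus ?thesis
      using F1 \<alpha>_closed[OF n] ep.f_s[OF \<alpha>_closed[OF n]] by simp
  qed
  have \<mu>_base: "\<mu> n = F \<one>\<^bsub>B\<^esub>" if "n \<in> N" "l n = (F, \<one>\<^bsub>B\<^esub>)" for n F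
    using that l_N[OF that(1)] W.shapiro_base by (simp add: \<mu>_def)
  have \<mu>_hom: "\<mu> \<in> hom (P\<lparr>carrier := N\<rparr>) H"
    by (rule homI) (simp_all add: \<mu>_closed \<mu>_mult)

  have K_img: "\<exists>n\<in>N. \<mu> n = k'" if k': "k' \<in> K" for k'
  proof -
    obtain b where b: "b \<in> carrier B" "b \<notin> \<pi> ` N" using index[of "\<one>\<^bsub>B\<^esub>"] by auto
    obtain n where n: "n \<in> N"
      "l n = (\<lambda>x\<in>carrier B. inv\<^bsub>H\<^esub> (W.delta \<one>\<^bsub>B\<^esub> k' (b \<otimes>\<^bsub>B\<^esub> x)) \<otimes>\<^bsub>H\<^esub> W.delta \<one>\<^bsub>B\<^esub> k' x, \<one>\<^bsub>B\<^esub>)"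
      using commutator[OF W.delta_base[OF B.one_closed k'] b(1)] by blast
    have "W.delta \<one>\<^bsub>B\<^esub> k' b = \<one>\<^bsub>H\<^esub>"
      using b by (intro W.delta_outside) simp_all
    hence "\<mu> n = k'"
      using \<mu>_base[OF n] b k' K.subset W.delta_self[OF B.one_closed k'] by auto
    thus ?thesis using n(1) by blast
  qed
  have \<mu>_surj: "\<mu> ` N = carrier H"
  proof
    show "\<mu> ` N \<subseteq> carrier H" using \<mu>_closed by blast
    show "carrier H \<subseteq> \<mu> ` N"
    proof
      fix h assume h: "h \<in> carrier H"
      hence "f h \<in> \<alpha> ` N" using \<alpha>_surj f.hom_closed by simp
      then obtain n where n: "n \<in> N" "f h = \<alpha> n" by blast
      have "inv\<^bsub>H\<^esub> (\<mu> n) \<otimes>\<^bsub>H\<^esub> h \<in> K"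
        using h n \<mu>_closed f_\<mu> \<alpha>_closed by (simp add: K_iff)
      then obtain n' where n': "n' \<in> N" "\<mu> n' = inv\<^bsub>H\<^esub> (\<mu> n) \<otimes>\<^bsub>H\<^esub> h" using K_img by blast
      have "\<mu> (n \<otimes> n') = h"
        using \<mu>_mult[OF n(1) n'(1)] n' h \<mu>_closed[OF n(1)] H.m_assoc[of "\<mu> n" "inv\<^bsub>H\<^esub> (\<mu> n)" h]
        by simp
      thus "h \<in> \<mu> ` N" using n n' N.m_closed by blast
    qed
  qed
  have \<mu>_cont: "continuous_map (subtopology T N) (discrete_topology (carrier H)) \<mu>"
  proof (rule continuous_map_discrete_comp[OF continuous_map_from_subtopology[OF l_cont]])
    \<comment> \<open>\<open>shapiro\<close> takes values in \<open>H\<close> only over \<open>B\<^sub>0\<close>; a default value makes it total.\<close>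
    show "(\<lambda>e. if e \<in> W.base \<times> \<pi> ` N then W.shapiro e else \<one>\<^bsub>H\<^esub>) \<in> carrier W.wreath \<rightarrow> carrier H"
      using W.shapiro_closed by auto
    show "\<mu> n = (if l n \<in> W.base \<times> \<pi> ` N then W.shapiro (l n) else \<one>\<^bsub>H\<^esub>)"
      if "n \<in> topspace (subtopology T N)" for n
      using that l_N by (simp add: \<mu>_def)
  qed
  have sol: "\<mu> \<in> proper_solutions (P\<lparr>carrier := N\<rparr>) (subtopology T N) H \<alpha> f"
    using \<mu>_hom \<mu>_surj \<mu>_cont f_\<mu> by (simp add: proper_solutions_def epi_def) (simp add: \<mu>_def)

  have "(\<forall>n\<in>N. \<mu> n = \<one>\<^bsub>H\<^esub> \<longrightarrow> \<mu> (p \<otimes> n \<otimes> inv p) = \<one>\<^bsub>H\<^esub>) \<longleftrightarrow> \<pi> p \<in> \<pi> ` N"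
    if p: "p \<in> carrier P" for p
  proof
    assume "\<pi> p \<in> \<pi> ` N"
    hence lp: "l p \<in> W.base \<times> \<pi> ` N"
      using l_pair[OF p] by (metis SigmaI)
    have lip: "l (inv p) \<in> W.base \<times> \<pi> ` N"
      using subgroup.m_inv_closed[OF W.subgroup_shapiro_domain lp] p by simp
    have one: "W.shapiro (l p) \<otimes>\<^bsub>H\<^esub> W.shapiro (l (inv p)) = \<one>\<^bsub>H\<^esub>"
    proof -
      have "l p \<otimes>\<^bsub>W.wreath\<^esub> l (inv p) = \<one>\<^bsub>W.wreath\<^esub>" using p l.hom_closed[OF p] by simp
      hence "W.shapiro (l p) \<otimes>\<^bsub>H\<^esub> W.shapiro (l (inv p)) = W.shapiro \<one>\<^bsub>W.wreath\<^esub>"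
        using W.shapiro_mult[OF lp lip] by simp
      thus ?thesis using W.shapiro_base[OF W.base_one] by simp
    qed
    show "\<forall>n\<in>N. \<mu> n = \<one>\<^bsub>H\<^esub> \<longrightarrow> \<mu> (p \<otimes> n \<otimes> inv p) = \<one>\<^bsub>H\<^esub>"
    proof (intro ballI impI)
      fix n assume n: "n \<in> N" "\<mu> n = \<one>\<^bsub>H\<^esub>"
      have nP: "n \<in> carrier P" using n N.subset by blast
      have pn: "l p \<otimes>\<^bsub>W.wreath\<^esub> l n \<in> W.base \<times> \<pi> ` N"
        by (rule subgroup.m_closed[OF W.subgroup_shapiro_domain lp l_N[OF n(1)]])
      have "\<mu> (p \<otimes> n \<otimes> inv p) = W.shapiro (l p \<otimes>\<^bsub>W.wreath\<^esub> l n \<otimes>\<^bsub>W.wreath\<^esub> l (inv p))"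
        using p nP N.inv_op_closed2[OF p n(1)] by (simp add: \<mu>_def del: l.hom_inv)
      also have "\<dots> = W.shapiro (l p) \<otimes>\<^bsub>H\<^esub> W.shapiro (l n) \<otimes>\<^bsub>H\<^esub> W.shapiro (l (inv p))"
        using W.shapiro_mult[OF pn lip] W.shapiro_mult[OF lp l_N[OF n(1)]] by simp
      also have "W.shapiro (l n) = \<one>\<^bsub>H\<^esub>" using n by (simp add: \<mu>_def)
      finally show "\<mu> (p \<otimes> n \<otimes> inv p) = \<one>\<^bsub>H\<^esub>"
        using one W.shapiro_closed[OF lp] by simp
    qed
  next
    assume stab: "\<forall>n\<in>N. \<mu> n = \<one>\<^bsub>H\<^esub> \<longrightarrow> \<mu> (p \<otimes> n \<otimes> inv p) = \<one>\<^bsub>H\<^esub>"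
    show "\<pi> p \<in> \<pi> ` N"
    proof (rule ccontr)
      assume p0: "\<pi> p \<notin> \<pi> ` N"
      define t where "t = inv\<^bsub>B\<^esub> (\<pi> p)"
      have \<pi>p: "\<pi> p \<in> carrier B" using p by simp
      have t: "t \<in> carrier B" "inv\<^bsub>B\<^esub> t = \<pi> p" using \<pi>p by (simp_all add: t_def)
      obtain b where b: "b \<in> carrier B" "b \<notin> \<pi> ` N" "\<pi> p \<otimes>\<^bsub>B\<^esub> b \<notin> \<pi> ` N"
        using index[OF \<pi>p] by blast
      \<comment> \<open>\<open>F\<close> lives on the cosets of \<open>t\<close> and of \<open>b\<^sup>-\<^sup>1 t\<close>; these are different, and
        neither contains \<open>\<one>\<close>.\<close>
      define F where "F = (\<lambda>x\<in>carrier B. inv\<^bsub>H\<^esub> (W.delta t k (b \<otimes>\<^bsub>B\<^esub> x)) \<otimes>\<^bsub>H\<^esub> W.delta t k x)"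
      obtain n where n: "n \<in> N" "l n = (F, \<one>\<^bsub>B\<^esub>)"
        using commutator[OF W.delta_base[OF t(1) k(1)] b(1)] unfolding F_def by blast
      have F: "F \<in> W.base" using l_N[OF n(1)] n(2) by simp
      have "W.delta t k b = \<one>\<^bsub>H\<^esub>" "W.delta t k \<one>\<^bsub>B\<^esub> = \<one>\<^bsub>H\<^esub>"
        using b p0 t by (intro W.delta_outside; simp add: \<pi>p)+
      hence F1: "F \<one>\<^bsub>B\<^esub> = \<one>\<^bsub>H\<^esub>" using b by (simp add: F_def)
      have "W.delta t k (b \<otimes>\<^bsub>B\<^esub> t) = \<one>\<^bsub>H\<^esub>"
      proof (rule W.delta_outside)
        show "inv\<^bsub>B\<^esub> t \<otimes>\<^bsub>B\<^esub> (b \<otimes>\<^bsub>B\<^esub> t) \<notin> \<pi> ` N"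
        proof
          assume "inv\<^bsub>B\<^esub> t \<otimes>\<^bsub>B\<^esub> (b \<otimes>\<^bsub>B\<^esub> t) \<in> \<pi> ` N"
          hence "t \<otimes>\<^bsub>B\<^esub> (inv\<^bsub>B\<^esub> t \<otimes>\<^bsub>B\<^esub> (b \<otimes>\<^bsub>B\<^esub> t)) \<otimes>\<^bsub>B\<^esub> inv\<^bsub>B\<^esub> t \<in> \<pi> ` N"
            by (rule B\<^sub>0.inv_op_closed2[OF t(1)])
          moreover have "t \<otimes>\<^bsub>B\<^esub> (inv\<^bsub>B\<^esub> t \<otimes>\<^bsub>B\<^esub> (b \<otimes>\<^bsub>B\<^esub> t)) \<otimes>\<^bsub>B\<^esub> inv\<^bsub>B\<^esub> t = b"
            using b t(1) B.m_assoc[of t "inv\<^bsub>B\<^esub> t" "b \<otimes>\<^bsub>B\<^esub> t"] B.m_assoc[of b t "inv\<^bsub>B\<^esub> t"]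
            by (simp del: t(2))
          ultimately show False using b by simp
        qed
      qed (use b t in simp)
      hence Ft: "F t = k"
        using t b k K.subset W.delta_self[OF t(1) k(1)] by (auto simp: F_def)
      obtain L where L: "l p = (L, \<pi> p)" "L \<in> W.base"
        by (rule that[OF l_pair[OF p]])
      have nP: "n \<in> carrier P" using n N.subset by blast
      have "l (p \<otimes> n \<otimes> inv p) = l p \<otimes>\<^bsub>W.wreath\<^esub> l n \<otimes>\<^bsub>W.wreath\<^esub> inv\<^bsub>W.wreath\<^esub> (l p)"
        using p nP by simp
      also have "\<dots> = (\<lambda>x\<in>carrier B. L (t \<otimes>\<^bsub>B\<^esub> x) \<otimes>\<^bsub>H\<^esub> F (t \<otimes>\<^bsub>B\<^esub> x) \<otimes>\<^bsub>H\<^esub> inv\<^bsub>H\<^esub> (L (t \<otimes>\<^bsub>B\<^esub> x)), \<one>\<^bsub>B\<^esub>)"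
        unfolding L n(2) t_def by (rule W.conjugate_base[OF F L(2) \<pi>p])
      finally have "\<mu> (p \<otimes> n \<otimes> inv p) = L t \<otimes>\<^bsub>H\<^esub> k \<otimes>\<^bsub>H\<^esub> inv\<^bsub>H\<^esub> (L t)"
        using \<mu>_base N.inv_op_closed2[OF p n(1)] t(1) Ft by simp
      moreover have "\<mu> (p \<otimes> n \<otimes> inv p) = \<one>\<^bsub>H\<^esub>"
        using stab n(1) \<mu>_base[OF n] F1 by simp
      ultimately have c: "L t \<otimes>\<^bsub>H\<^esub> k \<otimes>\<^bsub>H\<^esub> inv\<^bsub>H\<^esub> (L t) = \<one>\<^bsub>H\<^esub>" by simp
      have Lt: "L t \<in> carrier H" "k \<in> carrier H" using L t k K.subset by auto
      have "L t \<otimes>\<^bsub>H\<^esub> k = L t"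
        using c Lt H.inv_solve_right[of "L t" "L t \<otimes>\<^bsub>H\<^esub> k" "L t"] H.m_assoc
        by (metis H.inv_closed H.m_closed H.l_inv H.r_one H.l_one)
      thus False using k Lt H.r_cancel_one by simp
    qed
  qed
  hence "{p \<in> carrier P. \<forall>n\<in>N. \<mu> n = \<one>\<^bsub>H\<^esub> \<longrightarrow> \<mu> (p \<otimes> n \<otimes> inv p) = \<one>\<^bsub>H\<^esub>}
      = {p \<in> carrier P. \<pi> p \<in> \<pi> ` N}" by blast
  with sol show thesis by (rule that)
qed

section \<open>There are at least \<open>m\<close> proper solutions\<close>

lemma card_le_by_finite_fibres:
  assumes "infinite X" and "\<And>x. x \<in> X \<Longrightarrow> h x \<in> S" and "\<And>y. y \<in> S \<Longrightarrow> finite {x \<in> X. h x = y}"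
  shows "|X| \<le>o |S|"
proof -
  have X: "X = (\<Union>y\<in>S. {x \<in> X. h x = y})" using assms(2) by blast
  have "infinite S"
  proof
    assume "finite S"
    hence "finite (\<Union>y\<in>S. {x \<in> X. h x = y})" using assms(3) by blast
    thus False using X assms(1) by metis
  qed
  moreover have "|{x \<in> X. h x = y}| \<le>o |S|" if "y \<in> S" for y
    using ordLeq_total[OF card_of_Well_order card_of_Well_order]
      card_of_ordLeq_finite[OF _ assms(3)[OF that]] \<open>infinite S\<close> by blast
  ultimately have "|\<Union>y\<in>S. {x \<in> X. h x = y}| \<le>o |S|"
    by (intro card_of_UNION_ordLeq_infinite) (auto simp: card_of_refl ordIso_imp_ordLeq)
  thus ?thesis using X by simp
qed

lemma finite_split_embedding_problem_product:
  assumes "Group.group A" "finite (carrier A)" "Group.group C" "finite (carrier C)"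
    and "\<pi> \<in> epi P A" "continuous_map T (discrete_topology (carrier A)) \<pi>"
  shows "finite_split_embedding_problem P T A (A \<times>\<times> C) \<pi> fst (\<lambda>a. (a, \<one>\<^bsub>C\<^esub>))"
proof (rule finite_split_embedding_problem.intro)
  interpret A: Group.group A by fact
  interpret C: Group.group C by fact
  show "Group.group (A \<times>\<times> C)" by (rule DirProd_group) fact+
  have "fst ` carrier (A \<times>\<times> C) = carrier A" using C.one_closed by force
  moreover have "fst \<in> hom (A \<times>\<times> C) A" by (rule homI) auto
  ultimately show "fst \<in> epi (A \<times>\<times> C) A" by (simp add: epi_def)
  show "(\<lambda>a. (a, \<one>\<^bsub>C\<^esub>)) \<in> hom A (A \<times>\<times> C)" by (rule homI) auto
qed (use assms in auto)

text \<open>Different solutions \<open>l\<close> of one wreath product problem may agree on \<open>N\<close>, as they can differ by a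
  homomorphism to an abelian group, so the \<open>m\<close> solutions over a fixed \<open>\<pi>\<close> cannot simply be
  restricted to \<open>N\<close>. Instead \<open>\<pi>\<close> itself varies. With \<open>A\<close> a finite quotient of \<open>P\<close> through which
  \<open>\<alpha>\<close> factors and \<open>C\<close> of order 3, quasi-freeness gives \<open>m\<close> epimorphisms \<open>\<pi>\<close> onto \<open>A \<times> C\<close> lifting
  \<open>P \<rightarrow> A\<close>. The \<open>C\<close>-component kills \<open>N\<close>, so \<open>\<pi> ` N\<close> has index at least 3. Each \<open>\<pi>\<close> gives a solution
  on \<open>N\<close> that determines \<open>N \<cdot> ker \<pi>\<close>, a subgroup of finite index that determines
  \<open>\<pi>\<close> up to finitely many choices. A map with finite fibres on an infinite set of size \<open>m\<close> has at
  least \<open>m\<close> values.\<close>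

lemma (in profinite_group) card_proper_solutions_ge:
  assumes qf: "quasi_free P T m" and m: "Cinfinite m"
  defines "N \<equiv> closed_commutator_subgroup P T"
  assumes ep: "finite_split_embedding_problem (P\<lparr>carrier := N\<rparr>) (subtopology T N) G H \<alpha> f s"
    and nt: "nontrivial_embedding_problem G H f"
  shows "m \<le>o |proper_solutions (P\<lparr>carrier := N\<rparr>) (subtopology T N) H \<alpha> f|"
proof -
  let ?S = "proper_solutions (P\<lparr>carrier := N\<rparr>) (subtopology T N) H \<alpha> f"
  let ?stab = "\<lambda>\<mu>. {p \<in> carrier P. \<forall>n\<in>N. \<mu> n = \<one>\<^bsub>H\<^esub> \<longrightarrow> \<mu> (p \<otimes> n \<otimes> inv p) = \<one>\<^bsub>H\<^esub>}"
  have N: "N \<lhd> P" unfolding N_def by (rule closed_commutator_subgroup_normal)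
  interpret N: normal N P by fact
  interpret ep: finite_split_embedding_problem "P\<lparr>carrier := N\<rparr>" "subtopology T N" G H \<alpha> f s
    by fact
  have "\<alpha> \<in> hom (P\<lparr>carrier := N\<rparr>) G" using ep.alpha_epi by (simp add: epi_def)
  then obtain D where D: "D \<lhd> P" "openin T D" "\<And>x. x \<in> N \<Longrightarrow> x \<in> D \<Longrightarrow> \<alpha> x = \<one>\<^bsub>G\<^esub>"
    using hom_on_subgroup_factors_mod_open_normal[OF N.is_subgroup _ ep.group_G ep.alpha_continuous]
    by blast
  interpret D: normal D P by fact
  note quot = open_normal_quotient[OF D(1,2)]
  define C where "C = integer_mod_group 3"
  define B where "B = (P Mod D) \<times>\<times> C"
  have C: "carrier C = {0..<3}" "\<one>\<^bsub>C\<^esub> = 0" by (simp_all add: C_def carrier_integer_mod_group)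
  interpret C: comm_group C unfolding C_def by (rule abelian_integer_mod_group)
  interpret A: Group.group "P Mod D" by (rule D.factorgroup_is_group)
  interpret B: Group.group B
    unfolding B_def by (rule DirProd_group) (rule A.is_group C.is_group)+
  have B: "carrier B = carrier (P Mod D) \<times> {0..<3}" "\<one>\<^bsub>B\<^esub> = (D, 0)"
    by (simp_all add: B_def C)
  have snd_B: "snd (b \<otimes>\<^bsub>B\<^esub> b') = (snd b + snd b') mod 3" for b b'
    by (simp add: B_def C_def mult_DirProd')
  have finB: "finite (carrier B)" using quot(1) by (simp add: B)
  define X where "X = proper_solutions P T B (\<lambda>x. D #> x) fst"

  have "|X| =o m"
    unfolding X_def
  proof (rule quasi_free_proper_solutions[OF qf])
    show "finite_split_embedding_problem P T (P Mod D) B (\<lambda>x. D #> x) fst (\<lambda>a. (a, \<one>\<^bsub>C\<^esub>))"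
      unfolding B_def
    proof (rule finite_split_embedding_problem_product)
      show "finite (carrier C)" by (simp add: C(1))
    qed (rule A.is_group C.is_group quot)+
    have "(D, 1) \<in> kernel B (P Mod D) fst"
      using A.one_closed by (simp add: kernel_def B)
    moreover have "(D, 1) \<noteq> \<one>\<^bsub>B\<^esub>" by (simp add: B(2))
    ultimately show "nontrivial_embedding_problem (P Mod D) B fst"
      unfolding nontrivial_embedding_problem_def by (metis singletonD)
  qed
  have "infinite X" by (rule infinite_if_ordIso_Cinfinite[OF m \<open>|X| =o m\<close>])

  have X: "\<pi> \<in> epi P B" "continuous_map T (discrete_topology (carrier B)) \<pi>"
      "\<And>x. x \<in> carrier P \<Longrightarrow> fst (\<pi> x) = D #> x" "\<pi> \<in> extensional (carrier P)"
    if "\<pi> \<in> X" for \<pi>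
    using that by (auto simp: X_def proper_solutions_def)
  have X_hom: "group_hom P B \<pi>" if "\<pi> \<in> X" for \<pi>
    using X(1)[OF that] by (intro group_hom.intro group_hom_axioms.intro)
      (simp_all add: epi_def B.is_group)
  have snd_N: "snd (\<pi> n) = 0" if \<pi>: "\<pi> \<in> X" and n: "n \<in> N" for \<pi> n
  proof -
    interpret \<pi>: group_hom P B \<pi> by (rule X_hom[OF \<pi>])
    have "(\<lambda>x. snd (\<pi> x)) \<in> hom P C"
    proof (rule homI)
      show "snd (\<pi> x) \<in> carrier C" if "x \<in> carrier P" for x
        using \<pi>.hom_closed[OF that] by (auto simp: B C)
      show "snd (\<pi> (x \<otimes> y)) = snd (\<pi> x) \<otimes>\<^bsub>C\<^esub> snd (\<pi> y)" if "x \<in> carrier P" "y \<in> carrier P" for x y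
        using \<pi>.hom_mult[OF that] by (simp add: snd_B C_def)
    qed
    moreover have "continuous_map T (discrete_topology (carrier C)) (\<lambda>x. snd (\<pi> x))"
      by (rule continuous_map_discrete_comp[OF X(2)[OF \<pi>], of snd]) (auto simp: B C)
    ultimately have "snd (\<pi> n) = \<one>\<^bsub>C\<^esub>"
      using closed_commutator_subgroup_in_kernel[OF C.comm_group_axioms] n unfolding N_def by blast
    thus ?thesis by (simp add: C)
  qed

  have "\<exists>\<mu>\<in>?S. ?stab \<mu> = {p \<in> carrier P. \<pi> p \<in> \<pi> ` N}" if \<pi>: "\<pi> \<in> X" for \<pi>
  proof -
    have ker: "\<alpha> n = \<one>\<^bsub>G\<^esub>" if n: "n \<in> N" "\<pi> n = \<one>\<^bsub>B\<^esub>" for n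
    proof -
      have nP: "n \<in> carrier P" using n N.subset by blast
      have "D #> n = D" using X(3)[OF \<pi> nP] n(2) by (simp add: B)
      hence "n \<in> D" using rcos_self[OF nP D.is_subgroup] by simp
      thus ?thesis using D(3) n by blast
    qed
    have index: "\<exists>b\<in>carrier B. b \<notin> \<pi> ` N \<and> t \<otimes>\<^bsub>B\<^esub> b \<notin> \<pi> ` N" if t: "t \<in> carrier B" for t
    proof -
      \<comment> \<open>In a group of order 3 there is an element different from two prescribed ones, here from
        \<open>0\<close> and \<open>- snd t\<close>.\<close>
      define c :: int where "c = (if snd t = 2 then 2 else 1)"
      have "snd t \<in> {0..<3}" using t by (auto simp: B)
      hence "snd t = 0 \<or> snd t = 1 \<or> snd t = 2" by auto
      hence "(snd t + c) mod 3 \<noteq> 0" "c \<noteq> 0" "(D, c) \<in> carrier B"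
        using A.one_closed by (auto simp: c_def B)
      moreover have "snd (t \<otimes>\<^bsub>B\<^esub> (D, c)) = (snd t + c) mod 3" by (simp add: snd_B)
      moreover have "b \<notin> \<pi> ` N" if "snd b \<noteq> 0" for b
        using snd_N[OF \<pi>] that by blast
      ultimately show ?thesis by (metis snd_conv)
    qed
    show ?thesis
      by (rule normal_subgroup_proper_solution[OF qf m N _ ep nt B.is_group finB X(1,2)[OF \<pi>] ker index])
        (auto simp: N_def commutator_in_closed_commutator_subgroup)
  qed
  hence "\<forall>\<pi>\<in>X. \<exists>\<mu>. \<mu> \<in> ?S \<and> ?stab \<mu> = {p \<in> carrier P. \<pi> p \<in> \<pi> ` N}" by blast
  from bchoice[OF this] obtain M where
    "\<forall>\<pi>\<in>X. M \<pi> \<in> ?S \<and> ?stab (M \<pi>) = {p \<in> carrier P. \<pi> p \<in> \<pi> ` N}" ..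
  hence M: "\<And>\<pi>. \<pi> \<in> X \<Longrightarrow> M \<pi> \<in> ?S"
    "\<And>\<pi>. \<pi> \<in> X \<Longrightarrow> ?stab (M \<pi>) = {p \<in> carrier P. \<pi> p \<in> \<pi> ` N}" by blast+

  \<comment> \<open>If \<open>\<pi>\<close> and \<open>\<pi>\<^sub>1\<close> have the same image under \<open>M\<close>, then \<open>\<pi>\<close> is constant on the fibres of
    \<open>\<pi>\<^sub>1\<close>, and there are only finitely many maps from the finite group \<open>B\<close> to itself.\<close>
  have "finite {\<pi> \<in> X. M \<pi> = \<mu>}" for \<mu>
  proof (cases "{\<pi> \<in> X. M \<pi> = \<mu>} = {}")
    case False
    then obtain \<pi>\<^sub>1 where \<pi>\<^sub>1: "\<pi>\<^sub>1 \<in> X" "M \<pi>\<^sub>1 = \<mu>" by blast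
    interpret \<pi>\<^sub>1: group_hom P B \<pi>\<^sub>1 by (rule X_hom[OF \<pi>\<^sub>1(1)])
    have surj: "\<pi>\<^sub>1 ` carrier P = carrier B" using X(1)[OF \<pi>\<^sub>1(1)] by (simp add: epi_def)
    have eq: "\<pi> p = \<pi> q"
      if \<pi>: "\<pi> \<in> X" "M \<pi> = \<mu>" and p: "p \<in> carrier P" and q: "q \<in> carrier P"
        and "\<pi>\<^sub>1 p = \<pi>\<^sub>1 q" for \<pi> p q
    proof -
      interpret \<pi>: group_hom P B \<pi> by (rule X_hom[OF \<pi>(1)])
      have "\<pi>\<^sub>1 (p \<otimes> inv q) = \<pi>\<^sub>1 \<one>" using that by simp
      hence "p \<otimes> inv q \<in> {p \<in> carrier P. \<pi>\<^sub>1 p \<in> \<pi>\<^sub>1 ` N}"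
        using p q N.one_closed by (metis (mono_tags, lifting) imageI inv_closed m_closed mem_Collect_eq)
      also have "\<dots> = {p \<in> carrier P. \<pi> p \<in> \<pi> ` N}"
        using M(2)[OF \<pi>\<^sub>1(1)] M(2)[OF \<pi>(1)] \<pi>\<^sub>1(2) \<pi>(2) by simp
      finally have "snd (\<pi> (p \<otimes> inv q)) = 0" using snd_N[OF \<pi>(1)] by force
      moreover have "\<pi> p = \<pi> (p \<otimes> inv q) \<otimes>\<^bsub>B\<^esub> \<pi> q"
        using p q \<pi>.hom_mult[of "p \<otimes> inv q" q] by (simp add: m_assoc del: \<pi>.hom_mult)
      ultimately have "snd (\<pi> p) = snd (\<pi> q) mod 3" by (simp add: snd_B)
      also have "\<dots> = snd (\<pi> q)" using \<pi>.hom_closed[OF q] by (auto simp: B)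
      finally have "snd (\<pi> p) = snd (\<pi> q)" .
      moreover have "fst (\<pi> p) = fst (\<pi> q)"
        using X(3)[OF \<pi>(1)] X(3)[OF \<pi>\<^sub>1(1)] p q \<open>\<pi>\<^sub>1 p = \<pi>\<^sub>1 q\<close> by metis
      ultimately show ?thesis by (simp add: prod_eq_iff)
    qed
    have "{\<pi> \<in> X. M \<pi> = \<mu>} \<subseteq> (\<lambda>g. \<lambda>p\<in>carrier P. g (\<pi>\<^sub>1 p)) ` (carrier B \<rightarrow>\<^sub>E carrier B)"
    proof
      fix \<pi> assume "\<pi> \<in> {\<pi> \<in> X. M \<pi> = \<mu>}"
      hence \<pi>: "\<pi> \<in> X" "M \<pi> = \<mu>" by auto
      interpret \<pi>: group_hom P B \<pi> by (rule X_hom[OF \<pi>(1)])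
      let ?r = "inv_into (carrier P) \<pi>\<^sub>1"
      have r: "?r b \<in> carrier P" "\<pi>\<^sub>1 (?r b) = b" if "b \<in> carrier B" for b
        using that surj by (auto intro: inv_into_into f_inv_into_f)
      have "\<pi> p = (\<lambda>b\<in>carrier B. \<pi> (?r b)) (\<pi>\<^sub>1 p)" if p: "p \<in> carrier P" for p
        using eq[OF \<pi> p r(1)] r(2) p by simp
      hence "\<pi> = (\<lambda>p\<in>carrier P. (\<lambda>b\<in>carrier B. \<pi> (?r b)) (\<pi>\<^sub>1 p))"
        by (intro extensionalityI[OF X(4)[OF \<pi>(1)]]) auto
      moreover have "(\<lambda>b\<in>carrier B. \<pi> (?r b)) \<in> carrier B \<rightarrow>\<^sub>E carrier B" using r by auto
      ultimately show "\<pi> \<in> (\<lambda>g. \<lambda>p\<in>carrier P. g (\<pi>\<^sub>1 p)) ` (carrier B \<rightarrow>\<^sub>E carrier B)"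
        by (rule image_eqI)
    qed
    thus ?thesis by (rule finite_subset) (intro finite_imageI finite_PiE finB)
  next
    case True
    show ?thesis by (subst True) simp
  qed
  with \<open>infinite X\<close> M(1) have "|X| \<le>o |?S|" by (intro card_le_by_finite_fibres[of X M]) auto
  thus ?thesis using \<open>|X| =o m\<close> ordIso_symmetric ordIso_ordLeq_trans by blast
qed

section \<open>There are at most \<open>m\<close> proper solutions\<close>

text \<open>Multiplication tables form a countable set that represents every finite group up to isomorphism.
  A code \<open>(n, xs, e)\<close> lists the rows of the table in \<open>xs\<close>; it need not describe a group.\<close>

definition table_group :: "nat \<times> nat list \<times> nat \<Rightarrow> nat monoid" where
  "table_group = (\<lambda>(n, xs, e).
     \<lparr>carrier = {..<n}, monoid.mult = (\<lambda>a b. xs ! (a * n + b)), one = e\<rparr>)"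

lemma finite_group_iso_table_group:
  assumes A: "Group.group A" and fin: "finite (carrier A)"
  obtains c q where "Group.group (table_group c)" "q \<in> iso A (table_group c)"
proof -
  interpret A: Group.group A by fact
  obtain q n where q: "q ` carrier A = {i :: nat. i < n}" "inj_on q (carrier A)"
    using finite_imp_inj_to_nat_seg[OF fin] by blast
  let ?r = "inv_into (carrier A) q"
  have r: "?r (q x) = x" if "x \<in> carrier A" for x using that q by simp
  have lt: "q x < n" if "x \<in> carrier A" for x using that q by blast
  define xs where "xs = map (\<lambda>k. q (?r (k div n) \<otimes>\<^bsub>A\<^esub> ?r (k mod n))) [0..<n * n]"
  define c where "c = (n, xs, q \<one>\<^bsub>A\<^esub>)"
  have hom: "q \<in> hom A (table_group c)"
  proof (rule homI)
    show "q x \<in> carrier (table_group c)" if "x \<in> carrier A" for x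
      using lt[OF that] by (simp add: table_group_def c_def)
    show "q (x \<otimes>\<^bsub>A\<^esub> y) = q x \<otimes>\<^bsub>table_group c\<^esub> q y" if x: "x \<in> carrier A" and y: "y \<in> carrier A" for x y
    proof -
      have "q x * n + q y < q x * n + n" using lt[OF y] by simp
      also have "\<dots> = (q x + 1) * n" by simp
      also have "\<dots> \<le> n * n" using lt[OF x] by (intro mult_right_mono) simp_all
      finally have "q x * n + q y < n * n" .
      thus ?thesis
        using lt[OF y] r x y by (simp add: table_group_def c_def xs_def)
    qed
  qed
  have "q ` carrier A = carrier (table_group c)"
    using q(1) by (auto simp: table_group_def c_def)
  hence iso: "q \<in> iso A (table_group c)"
    using hom q(2) by (simp add: iso_def bij_betw_def)
  have "(table_group c)\<lparr>one := q \<one>\<^bsub>A\<^esub>\<rparr> = table_group c"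
    by (simp add: table_group_def c_def)
  with A.iso_imp_img_group[OF iso] have "Group.group (table_group c)" by simp
  with iso show ?thesis using that by blast
qed

lemma card_of_countable_ordLeq:
  assumes "Cinfinite m" "countable A"
  shows "|A| \<le>o m"
proof -
  have "|A| \<le>o |UNIV :: nat set|"
    using assms(2) card_of_ordLeq[of A "UNIV :: nat set"] unfolding countable_def by blast
  also have "|UNIV :: nat set| =o natLeq" by (rule card_of_nat)
  also have "natLeq \<le>o m" by (rule natLeq_ordLeq_cinfinite) (rule assms(1))
  finally show ?thesis .
qed

lemma card_of_UNION_ordLeq_Cinfinite:
  assumes "Cinfinite m" "countable I" "\<And>i. i \<in> I \<Longrightarrow> |A i| \<le>o m"
  shows "|\<Union>i\<in>I. A i| \<le>o m"
  using assms card_of_countable_ordLeq[OF assms(1,2)]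
  by (intro card_of_UNION_ordLeq_infinite_Field) (auto simp: cinfinite_def)

text \<open>These epimorphisms are the proper solutions over the trivial group; only the trivial \<open>A\<close> gives a
  trivial embedding problem, and then there is just one map.\<close>

lemma card_of_continuous_epis_le:
  assumes qf: "quasi_free P T m" and m: "Cinfinite m"
    and A: "Group.group A" "finite (carrier A)"
  shows "|{\<pi> \<in> extensional (carrier P). \<pi> \<in> epi P A \<and>
      continuous_map T (discrete_topology (carrier A)) \<pi>}| \<le>o m"
proof -
  interpret profinite_group P T using qf by (simp add: quasi_free_def)
  interpret A: Group.group A by fact
  define U :: "unit monoid" where "U = \<lparr>carrier = UNIV, monoid.mult = (\<lambda>_ _. ()), one = ()\<rparr>"
  have U: "Group.group U" by (rule groupI) (auto simp: U_def)
  have epi_U: "(\<lambda>_. ()) \<in> epi Q U" if "Group.group Q" for Q :: "('x, 'y) monoid_scheme"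
    using group.is_monoid[OF that] monoid.one_closed[of Q] by (auto simp: U_def epi_def hom_def)
  have eq: "{\<pi> \<in> extensional (carrier P). \<pi> \<in> epi P A \<and>
      continuous_map T (discrete_topology (carrier A)) \<pi>} =
      proper_solutions P T A (\<lambda>_. ()) (\<lambda>_. ())"
    by (auto simp: proper_solutions_def)
  have ep: "finite_split_embedding_problem P T U A (\<lambda>_. ()) (\<lambda>_. ()) (\<lambda>_. \<one>\<^bsub>A\<^esub>)"
    by (intro finite_split_embedding_problem.intro U A epi_U is_group homI)
      (simp_all add: U_def)
  show ?thesis
  proof (cases "nontrivial_embedding_problem U A (\<lambda>_. ())")
    case True
    show ?thesis
      unfolding eq using quasi_free_proper_solutions[OF qf ep True] by (rule ordIso_imp_ordLeq)
  next
    case False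
    hence "carrier A = {\<one>\<^bsub>A\<^esub>}"
      by (simp add: nontrivial_embedding_problem_def kernel_def U_def)
    hence "\<pi> = (\<lambda>x\<in>carrier P. \<one>\<^bsub>A\<^esub>)" if "\<pi> \<in> extensional (carrier P)" "\<pi> \<in> epi P A" for \<pi>
      using that by (intro extensionalityI[of _ "carrier P"]) (auto simp: epi_def hom_def)
    hence "proper_solutions P T A (\<lambda>_. ()) (\<lambda>_. ()) \<subseteq> {\<lambda>x\<in>carrier P. \<one>\<^bsub>A\<^esub>}"
      by (auto simp: proper_solutions_def)
    thus ?thesis
      unfolding eq by (intro card_of_countable_ordLeq[OF m]) (metis countable_finite finite.emptyI finite_insert finite_subset)
  qed
qed

text \<open>A continuous homomorphism \<open>l\<close> on \<open>S\<close> factors as a map after a finite quotient of \<open>P\<close>. There are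
  countably many finite groups, at most \<open>m\<close> epimorphisms from \<open>P\<close> onto each of them, and finitely many
  maps from each to \<open>A\<close>.\<close>

lemma card_of_continuous_homs_on_subgroup_le:
  fixes P (structure)
  assumes qf: "quasi_free P T m" and m: "Cinfinite m" and S: "subgroup S P"
    and A: "Group.group A" "finite (carrier A)"
  shows "|{l \<in> extensional S. l \<in> hom (P\<lparr>carrier := S\<rparr>) A \<and>
      continuous_map (subtopology T S) (discrete_topology (carrier A)) l}| \<le>o m"
    (is "|?L| \<le>o m")
proof -
  interpret profinite_group P T using qf by (simp add: quasi_free_def)
  interpret S: subgroup S P by fact
  interpret A: Group.group A by fact
  define epis where "epis c = {\<pi>. Group.group (table_group c) \<and> \<pi> \<in> extensional (carrier P) \<and>
      \<pi> \<in> epi P (table_group c) \<and>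
      continuous_map T (discrete_topology (carrier (table_group c))) \<pi>}" for c
  have epis: "|epis c| \<le>o m" for c
  proof (cases "Group.group (table_group c)")
    case True
    have "finite (carrier (table_group c))" by (cases c) (simp add: table_group_def)
    from card_of_continuous_epis_le[OF qf m True this] show ?thesis
      using True by (simp add: epis_def)
  next
    case False
    hence "epis c = {}" by (auto simp: epis_def)
    thus ?thesis by (simp add: card_of_countable_ordLeq[OF m])
  qed
  let ?maps = "\<lambda>c. carrier (table_group c) \<rightarrow>\<^sub>E carrier A"
  have "?L \<subseteq> (\<Union>c. \<Union>g\<in>?maps c. (\<lambda>\<pi>. \<lambda>x\<in>S. g (\<pi> x)) ` epis c)"
  proof
    fix l assume "l \<in> ?L"
    hence l: "l \<in> extensional S" "l \<in> hom (P\<lparr>carrier := S\<rparr>) A"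
      "continuous_map (subtopology T S) (discrete_topology (carrier A)) l" by auto
    interpret l: group_hom "P\<lparr>carrier := S\<rparr>" A l
      using subgroup_imp_group[OF S] l(2)
      by (intro group_hom.intro group_hom_axioms.intro) (simp_all add: A.is_group)
    obtain D where D: "D \<lhd> P" "openin T D" "\<And>x. x \<in> S \<Longrightarrow> x \<in> D \<Longrightarrow> l x = \<one>\<^bsub>A\<^esub>"
      using hom_on_subgroup_factors_mod_open_normal[OF S l(2) A(1) l(3)] by blast
    interpret D: normal D P by fact
    note quot = open_normal_quotient[OF D(1,2)]
    obtain c q where c: "Group.group (table_group c)" "q \<in> iso (P Mod D) (table_group c)"
      using finite_group_iso_table_group[OF D.factorgroup_is_group quot(1)] .
    have q: "inj_on q (carrier (P Mod D))" "q ` carrier (P Mod D) = carrier (table_group c)"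
      using c(2) by (auto simp: iso_def bij_betw_def)
    have Mod: "D #> x \<in> carrier (P Mod D)" if "x \<in> carrier P" for x
      using quot(2) that by (auto simp: epi_def hom_def)
    define \<pi> where "\<pi> = (\<lambda>x\<in>carrier P. q (D #> x))"
    have "\<pi> \<in> epi P (table_group c)"
      by (rule epi_comp_iso[OF quot(2) c(2) is_group]) (simp add: \<pi>_def)
    moreover have "continuous_map T (discrete_topology (carrier (table_group c))) \<pi>"
      by (rule continuous_map_discrete_comp[OF quot(3), of q]) (use q in \<open>auto simp: \<pi>_def topspace_eq\<close>)
    ultimately have \<pi>: "\<pi> \<in> epis c" using c(1) by (simp add: epis_def) (simp add: \<pi>_def)
    have eq: "l x = l y" if x: "x \<in> S" and y: "y \<in> S" and "\<pi> x = \<pi> y" for x y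
    proof -
      have xy: "x \<in> carrier P" "y \<in> carrier P" using x y S.subset by auto
      hence "D #> x = D #> y"
        using \<open>\<pi> x = \<pi> y\<close> inj_onD[OF q(1) _ Mod Mod] by (simp add: \<pi>_def)
      hence "x \<otimes> inv y \<in> D"
        using xy rcos_self[OF xy(1) D.is_subgroup] D.rcos_module[OF is_group xy(2) xy(1)] by simp
      moreover have "x \<otimes> inv y \<in> S" using x y by blast
      ultimately have "l (x \<otimes> inv y) = \<one>\<^bsub>A\<^esub>" using D(3) by blast
      moreover have "l (x \<otimes> inv y) \<otimes>\<^bsub>A\<^esub> l y = l (x \<otimes> inv y \<otimes> y)"
        using l.hom_mult[of "x \<otimes> inv y" y] x y by simp
      moreover have "x \<otimes> inv y \<otimes> y = x" using xy by (simp add: m_assoc)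
      ultimately show ?thesis using l.hom_closed[of y] y by simp
    qed
    define g where "g = (\<lambda>i\<in>carrier (table_group c).
        if i \<in> \<pi> ` S then l (inv_into S \<pi> i) else \<one>\<^bsub>A\<^esub>)"
    have inv: "inv_into S \<pi> i \<in> S" "\<pi> (inv_into S \<pi> i) = i" if "i \<in> \<pi> ` S" for i
      using that by (rule inv_into_into, rule f_inv_into_f)
    have "l (inv_into S \<pi> i) \<in> carrier A" if "i \<in> \<pi> ` S" for i
      using inv(1)[OF that] l.hom_closed by simp
    hence g: "g \<in> ?maps c" by (auto simp: g_def)
    have "g (\<pi> x) = l x" if x: "x \<in> S" for x
    proof -
      have "\<pi> x \<in> carrier (table_group c)"
        using x S.subset q(2) Mod by (auto simp: \<pi>_def)
      thus ?thesis using x eq[OF inv(1) x inv(2)] by (simp add: g_def)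
    qed
    hence "l = (\<lambda>x\<in>S. g (\<pi> x))"
      by (intro extensionalityI[OF l(1)]) auto
    hence "l \<in> (\<lambda>\<pi>. \<lambda>x\<in>S. g (\<pi> x)) ` epis c" using \<pi> by (rule image_eqI)
    with g show "l \<in> (\<Union>c. \<Union>g\<in>?maps c. (\<lambda>\<pi>. \<lambda>x\<in>S. g (\<pi> x)) ` epis c)" by blast
  qed
  hence "|?L| \<le>o |\<Union>c. \<Union>g\<in>?maps c. (\<lambda>\<pi>. \<lambda>x\<in>S. g (\<pi> x)) ` epis c|"
    by (rule card_of_mono1)
  also have "|\<Union>c. \<Union>g\<in>?maps c. (\<lambda>\<pi>. \<lambda>x\<in>S. g (\<pi> x)) ` epis c| \<le>o m"
  proof (intro card_of_UNION_ordLeq_Cinfinite[OF m])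
    show "countable (?maps c)" for c
      using A(2) by (intro countable_finite finite_PiE) (cases c, simp_all add: table_group_def)
    show "|(\<lambda>\<pi>. \<lambda>x\<in>S. g (\<pi> x)) ` epis c| \<le>o m" for c g
      using card_of_image epis by (rule ordLeq_transitive)
  qed simp
  finally show ?thesis .
qed

section \<open>The commutator subgroup\<close>

theorem theorem2p4:
  fixes P :: "('a, 'b) monoid_scheme" and T :: "'a topology" and m :: "'m rel"
  assumes "Cinfinite m"
    and "quasi_free P T m"
  shows "quasi_free (P\<lparr>carrier := closed_commutator_subgroup P T\<rparr>)
           (subtopology T (closed_commutator_subgroup P T)) m"
proof -
  interpret profinite_group P T using assms(2) by (simp add: quasi_free_def)
  let ?N = "closed_commutator_subgroup P T"
  have N: "subgroup ?N P"
    by (rule normal_imp_subgroup) (rule closed_commutator_subgroup_normal)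
  show ?thesis
    unfolding quasi_free_def
  proof (intro conjI allI impI)
    show "profinite_group (P\<lparr>carrier := ?N\<rparr>) (subtopology T ?N)"
      by (rule closed_subgroup_profinite[OF N]) (simp add: closed_commutator_subgroup_def)
    fix G H :: "nat monoid" and \<alpha> f s
    assume *: "finite_split_embedding_problem (P\<lparr>carrier := ?N\<rparr>) (subtopology T ?N) G H \<alpha> f s
        \<and> nontrivial_embedding_problem G H f"
    interpret ep: finite_split_embedding_problem "P\<lparr>carrier := ?N\<rparr>" "subtopology T ?N" G H \<alpha> f s
      using * by blast
    let ?S = "proper_solutions (P\<lparr>carrier := ?N\<rparr>) (subtopology T ?N) H \<alpha> f"
    have "?S \<subseteq> {l \<in> extensional ?N. l \<in> hom (P\<lparr>carrier := ?N\<rparr>) H \<and>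
        continuous_map (subtopology T ?N) (discrete_topology (carrier H)) l}"
      by (auto simp: proper_solutions_def epi_def)
    hence "|?S| \<le>o m"
      using card_of_continuous_homs_on_subgroup_le[OF assms(2,1) N ep.group_H ep.finite_H]
        card_of_mono1 ordLeq_transitive by blast
    moreover have "m \<le>o |?S|"
      using card_proper_solutions_ge[OF assms(2,1)] * by blast
    ultimately show "|?S| =o m" by (simp add: ordIso_iff_ordLeq)
  qed
qed

end
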